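(* Let $(M,\pi,\langle\cdot,\cdot\rangle,\mathcal{J})$ be an almost Kähler–Poisson manifold with contravariant Levi-Civita connection $\nabla^\bullet$. Then $(M,\pi,\langle\cdot,\cdot\rangle,\mathcal{J})$ is Kähler–Poisson (that is, $\nabla^\bullet\mathcal{J}=0$) if and only if $\nabla^\bullet\pi=0$, i.e., for all $\alpha,\beta,\gamma\in\Gamma(T^*M)$, $$\nabla^\bullet\pi(\alpha,\beta,\gamma):=\pi^\sharp(\alpha)\,\pi(\beta,\gamma)-\pi(\nabla^\alpha\beta,\gamma)-\pi(\beta,\nabla^\alpha\gamma)=0.$$ Moreover, the contravariant Nijenhuis tensor $$N_{\mathcal{J}}(\alpha,\beta):=[\mathcal{J}\alpha,\mathcal{J}\beta]_\pi+\mathcal{J}^2[\alpha,\beta]_\pi-\mathcal{J}\big([\alpha,\mathcal{J}\beta]_\pi+[\mathcal{J}\alpha,\beta]_\pi\big)$$ satisfies, for all one-forms $\alpha,\beta$, $$N_{\mathcal{J}}(\alpha,\beta)=\nabla^\bullet\mathcal{J}(\mathcal{J}\alpha,\beta)-\nabla^\bullet\mathcal{J}(\mathcal{J}\beta,\alpha)-\mathcal{J}\big(\nabla^\bullet\mathcal{J}(\alpha,\beta)-\nabla^\bullet\mathcal{J}(\beta,\alpha)\big).$$ In particular, $\nabla^\bullet\mathcal{J}=0$ implies $N_{\mathcal{J}}=0$.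
   Context: Let $M$ be a smooth manifold with a Poisson bivector $\pi$ (so $[\pi,\pi]=0$ for the Schouten bracket). The anchor $\pi^\sharp:T^*M\to TM$ is $\beta(\pi^\sharp\alpha)=\pi(\alpha,\beta)$. The Koszul bracket of one-forms is $[\alpha,\beta]_\pi=\mathcal{L}_{\pi^\sharp\alpha}\beta-\mathcal{L}_{\pi^\sharp\beta}\alpha-d(\pi(\alpha,\beta))$. A metric on $M$ means a pseudo-Riemannian metric; the symbol $\langle\cdot,\cdot\rangle$ here denotes the dual metric (cometric) on $T^*M$. The contravariant Levi-Civita connection $\nabla^\bullet$ of $(\pi,\langle\cdot,\cdot\rangle)$ is defined, for one-forms, by $$2\langle\nabla^\alpha\beta,\gamma\rangle=\pi^\sharp(\alpha)\langle\beta,\gamma\rangle+\pi^\sharp(\beta)\langle\alpha,\gamma\rangle-\pi^\sharp(\gamma)\langle\alpha,\beta\rangle+\langle[\alpha,\beta]_\pi,\gamma\rangle-\langle[\alpha,\gamma]_\pi,\beta\rangle-\langle[\beta,\gamma]_\pi,\alpha\rangle.$$ $(M,\pi,\langle\cdot,\cdot\rangle,\mathcal{J})$ is almost Kähler–Poisson if $\mathcal{J}:T^*M\to T^*M$ is a bundle map (over the identity) with $\mathcal{J}^3+\mathcal{J}=0$ and $\pi(\alpha,\beta)=\langle\alpha,\mathcal{J}\beta\rangle$ for all one-forms $\alpha,\beta$. It is Kähler–Poisson if in addition $\nabla^\bullet\mathcal{J}=0$, where $\nabla^\bullet\mathcal{J}(\alpha,\beta):=\nabla^\alpha(\mathcal{J}\beta)-\mathcal{J}(\nabla^\alpha\beta)$.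 *)

theory Defs
  imports "HOL-Analysis.Analysis"
begin

section \<open>Smooth manifolds\<close>

text \<open>On an open set S, \<open>Ck_on k S f\<close> says that f is of class $C^k$: for k + 1, that f is
  (Frechet) differentiable on S and all its directional derivatives are of class $C^k$.\<close>

primrec Ck_on :: "nat \<Rightarrow> 'a::euclidean_space set \<Rightarrow> ('a \<Rightarrow> 'b::euclidean_space) \<Rightarrow> bool" where
  "Ck_on 0 S f \<longleftrightarrow> continuous_on S f"
| "Ck_on (Suc k) S f \<longleftrightarrow>
     (\<forall>x\<in>S. f differentiable (at x)) \<and>
     (\<forall>v. Ck_on k S (\<lambda>x. frechet_derivative f (at x) v))"

definition smooth_on :: "'a::euclidean_space set \<Rightarrow> ('a \<Rightarrow> 'b::euclidean_space) \<Rightarrow> bool" where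
  "smooth_on S f \<longleftrightarrow> (\<forall>k. Ck_on k S f)"

type_synonym ('m, 'e) chart = "'m set \<times> ('m \<Rightarrow> 'e)"

text \<open>The manifold is a whole type, with its Hausdorff and second countable topology; its smooth
  structure is the one generated by the atlas A.  The model space is a Euclidean space of
  dimension \<open>DIM('e)\<close>.\<close>

definition smooth_manifold ::
  "('m::{t2_space,second_countable_topology}, 'e::euclidean_space) chart set \<Rightarrow> bool" where
  "smooth_manifold A \<longleftrightarrow>
     (\<forall>(U, \<phi>)\<in>A. open U \<and> open (\<phi> ` U) \<and> homeomorphism U (\<phi> ` U) \<phi> (inv_into U \<phi>)) \<and>
     (\<Union>(U, \<phi>)\<in>A. U) = UNIV \<and>
     (\<forall>(U, \<phi>)\<in>A. \<forall>(V, \<psi>)\<in>A. smooth_on (\<phi> ` (U \<inter> V)) (\<psi> \<circ> inv_into U \<phi>))"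

definition smooth_funs ::
  "('m::{t2_space,second_countable_topology}, 'e::euclidean_space) chart set \<Rightarrow> ('m \<Rightarrow> real) set" where
  "smooth_funs A = {f. \<forall>(U, \<phi>)\<in>A. smooth_on (\<phi> ` U) (f \<circ> inv_into U \<phi>)}"


section \<open>Linear algebra in spaces of real functions\<close>

text \<open>All vector spaces below (smooth functions, tangent and cotangent spaces) are sets V of real
  valued functions, closed under the pointwise operations.\<close>

definition linear_functional_on :: "('a \<Rightarrow> real) set \<Rightarrow> (('a \<Rightarrow> real) \<Rightarrow> real) \<Rightarrow> bool" where
  "linear_functional_on V L \<longleftrightarrow>
     (\<forall>x\<in>V. \<forall>y\<in>V. L (\<lambda>a. x a + y a) = L x + L y) \<and>
     (\<forall>c. \<forall>x\<in>V. L (\<lambda>a. c * x a) = c * L x)"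

definition linear_endo_on :: "('a \<Rightarrow> real) set \<Rightarrow> (('a \<Rightarrow> real) \<Rightarrow> 'a \<Rightarrow> real) \<Rightarrow> bool" where
  "linear_endo_on V T \<longleftrightarrow>
     (\<forall>x\<in>V. T x \<in> V) \<and>
     (\<forall>x\<in>V. \<forall>y\<in>V. T (\<lambda>a. x a + y a) = (\<lambda>a. T x a + T y a)) \<and>
     (\<forall>c. \<forall>x\<in>V. T (\<lambda>a. c * x a) = (\<lambda>a. c * T x a))"

definition bilinear_form_on ::
  "('a \<Rightarrow> real) set \<Rightarrow> (('a \<Rightarrow> real) \<Rightarrow> ('a \<Rightarrow> real) \<Rightarrow> real) \<Rightarrow> bool" where
  "bilinear_form_on V B \<longleftrightarrow>
     (\<forall>x\<in>V. linear_functional_on V (\<lambda>y. B x y)) \<and>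
     (\<forall>y\<in>V. linear_functional_on V (\<lambda>x. B x y))"


section \<open>Tangent and cotangent spaces, vector fields and one-forms\<close>

type_synonym 'm tvec = "('m \<Rightarrow> real) \<Rightarrow> real"
type_synonym 'm covec = "'m tvec \<Rightarrow> real"
type_synonym 'm vfield = "'m \<Rightarrow> 'm tvec"
type_synonym 'm form = "'m \<Rightarrow> 'm covec"

text \<open>Tangent vectors at p are the derivations at p of the algebra of smooth functions; covectors
  are the linear functionals on the tangent space.  Both are set to 0 outside of their domain, so
  that HOL equality is equality of vectors, respectively covectors.\<close>

definition tangent_space ::
  "('m::{t2_space,second_countable_topology}, 'e::euclidean_space) chart set \<Rightarrow> 'm \<Rightarrow> 'm tvec set" where
  "tangent_space A p = {v.
     linear_functional_on (smooth_funs A) v \<and>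
     (\<forall>f\<in>smooth_funs A. \<forall>g\<in>smooth_funs A. v (\<lambda>q. f q * g q) = v f * g p + f p * v g) \<and>
     (\<forall>f. f \<notin> smooth_funs A \<longrightarrow> v f = 0)}"

definition cotangent_space ::
  "('m::{t2_space,second_countable_topology}, 'e::euclidean_space) chart set \<Rightarrow> 'm \<Rightarrow> 'm covec set" where
  "cotangent_space A p = {\<xi>.
     linear_functional_on (tangent_space A p) \<xi> \<and>
     (\<forall>v. v \<notin> tangent_space A p \<longrightarrow> \<xi> v = 0)}"

definition vector_fields ::
  "('m::{t2_space,second_countable_topology}, 'e::euclidean_space) chart set \<Rightarrow> 'm vfield set" where
  "vector_fields A = {X.
     (\<forall>p. X p \<in> tangent_space A p) \<and>
     (\<forall>f\<in>smooth_funs A. (\<lambda>p. X p f) \<in> smooth_funs A)}"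

text \<open>The space of smooth sections of the cotangent bundle.\<close>

definition one_forms ::
  "('m::{t2_space,second_countable_topology}, 'e::euclidean_space) chart set \<Rightarrow> 'm form set" where
  "one_forms A = {\<alpha>.
     (\<forall>p. \<alpha> p \<in> cotangent_space A p) \<and>
     (\<forall>X\<in>vector_fields A. (\<lambda>p. \<alpha> p (X p)) \<in> smooth_funs A)}"

definition differential ::
  "('m::{t2_space,second_countable_topology}, 'e::euclidean_space) chart set \<Rightarrow> ('m \<Rightarrow> real) \<Rightarrow> 'm form" where
  "differential A f = (\<lambda>p v. if v \<in> tangent_space A p then v f else 0)"

definition lie_bracket ::
  "('m::{t2_space,second_countable_topology}, 'e::euclidean_space) chart set \<Rightarrow>
   'm vfield \<Rightarrow> 'm vfield \<Rightarrow> 'm vfield" where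
  "lie_bracket A X Y = (\<lambda>p f.
     if f \<in> smooth_funs A then X p (\<lambda>q. Y q f) - Y p (\<lambda>q. X q f) else 0)"

definition lie_derivative ::
  "('m::{t2_space,second_countable_topology}, 'e::euclidean_space) chart set \<Rightarrow>
   'm vfield \<Rightarrow> 'm form \<Rightarrow> 'm form" where
  "lie_derivative A X \<beta> = (THE \<omega>. \<omega> \<in> one_forms A \<and>
     (\<forall>Y\<in>vector_fields A. \<forall>p.
        \<omega> p (Y p) = X p (\<lambda>q. \<beta> q (Y q)) - \<beta> p (lie_bracket A X Y p)))"


section \<open>Poisson structures\<close>

type_synonym 'm cotensor2 = "'m \<Rightarrow> 'm covec \<Rightarrow> 'm covec \<Rightarrow> real"
type_synonym 'm tensor2 = "'m \<Rightarrow> 'm tvec \<Rightarrow> 'm tvec \<Rightarrow> real"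

definition bivector_field ::
  "('m::{t2_space,second_countable_topology}, 'e::euclidean_space) chart set \<Rightarrow> 'm cotensor2 \<Rightarrow> bool" where
  "bivector_field A P \<longleftrightarrow>
     (\<forall>p. bilinear_form_on (cotangent_space A p) (P p) \<and>
          (\<forall>\<xi>\<in>cotangent_space A p. \<forall>\<eta>\<in>cotangent_space A p. P p \<xi> \<eta> = - P p \<eta> \<xi>)) \<and>
     (\<forall>\<alpha>\<in>one_forms A. \<forall>\<beta>\<in>one_forms A. (\<lambda>p. P p (\<alpha> p) (\<beta> p)) \<in> smooth_funs A)"

text \<open>A bivector field P as a biderivation of the algebra of smooth functions.\<close>

definition biderivation ::
  "('m::{t2_space,second_countable_topology}, 'e::euclidean_space) chart set \<Rightarrow> 'm cotensor2 \<Rightarrow>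
   ('m \<Rightarrow> real) \<Rightarrow> ('m \<Rightarrow> real) \<Rightarrow> 'm \<Rightarrow> real" where
  "biderivation A P f g = (\<lambda>p. P p (differential A f p) (differential A g p))"

text \<open>The Schouten bracket of two bivector fields, as a triderivation of the algebra of smooth
  functions.  For multiderivations P, Q of degrees p, q the bracket $[P,Q](f_1,\dots,f_{p+q-1})$ is
  the signed sum of $P(Q(f_{\sigma(1)},\dots,f_{\sigma(q)}),f_{\sigma(q+1)},\dots)$ over
  (q,p-1)-shuffles, minus $(-1)^{(p-1)(q-1)}$ times the same sum with P and Q exchanged.  For
  p = q = 2 the three shuffles are (1,2;3), (1,3;2), (2,3;1), with signs +, -, +.\<close>

definition schouten_bracket ::
  "('m::{t2_space,second_countable_topology}, 'e::euclidean_space) chart set \<Rightarrow>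
   'm cotensor2 \<Rightarrow> 'm cotensor2 \<Rightarrow>
   ('m \<Rightarrow> real) \<Rightarrow> ('m \<Rightarrow> real) \<Rightarrow> ('m \<Rightarrow> real) \<Rightarrow> 'm \<Rightarrow> real" where
  "schouten_bracket A P Q f g h = (\<lambda>p.
     (biderivation A P (biderivation A Q f g) h p
        - biderivation A P (biderivation A Q f h) g p
        + biderivation A P (biderivation A Q g h) f p)
   + (biderivation A Q (biderivation A P f g) h p
        - biderivation A Q (biderivation A P f h) g p
        + biderivation A Q (biderivation A P g h) f p))"

definition poisson_bivector ::
  "('m::{t2_space,second_countable_topology}, 'e::euclidean_space) chart set \<Rightarrow> 'm cotensor2 \<Rightarrow> bool" where
  "poisson_bivector A \<pi> \<longleftrightarrow> bivector_field A \<pi> \<and>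
     (\<forall>f\<in>smooth_funs A. \<forall>g\<in>smooth_funs A. \<forall>h\<in>smooth_funs A.
        schouten_bracket A \<pi> \<pi> f g h = (\<lambda>p. 0))"

definition anchor ::
  "('m::{t2_space,second_countable_topology}, 'e::euclidean_space) chart set \<Rightarrow> 'm cotensor2 \<Rightarrow>
   'm form \<Rightarrow> 'm vfield" where
  "anchor A \<pi> \<alpha> = (\<lambda>p. THE v. v \<in> tangent_space A p \<and>
     (\<forall>\<xi>\<in>cotangent_space A p. \<xi> v = \<pi> p (\<alpha> p) \<xi>))"

definition koszul_bracket ::
  "('m::{t2_space,second_countable_topology}, 'e::euclidean_space) chart set \<Rightarrow> 'm cotensor2 \<Rightarrow>
   'm form \<Rightarrow> 'm form \<Rightarrow> 'm form" where
  "koszul_bracket A \<pi> \<alpha> \<beta> = (\<lambda>p v.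
     lie_derivative A (anchor A \<pi> \<alpha>) \<beta> p v
   - lie_derivative A (anchor A \<pi> \<beta>) \<alpha> p v
   - differential A (\<lambda>q. \<pi> q (\<alpha> q) (\<beta> q)) p v)"


section \<open>Metrics and the contravariant Levi-Civita connection\<close>

definition pseudo_riemannian_metric ::
  "('m::{t2_space,second_countable_topology}, 'e::euclidean_space) chart set \<Rightarrow> 'm tensor2 \<Rightarrow> bool" where
  "pseudo_riemannian_metric A G \<longleftrightarrow>
     (\<forall>p. bilinear_form_on (tangent_space A p) (G p) \<and>
          (\<forall>v\<in>tangent_space A p. \<forall>w\<in>tangent_space A p. G p v w = G p w v) \<and>
          (\<forall>v\<in>tangent_space A p. (\<forall>w\<in>tangent_space A p. G p v w = 0) \<longrightarrow> v = (\<lambda>f. 0))) \<and>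
     (\<forall>X\<in>vector_fields A. \<forall>Y\<in>vector_fields A. (\<lambda>p. G p (X p) (Y p)) \<in> smooth_funs A)"

definition metric_sharp ::
  "('m::{t2_space,second_countable_topology}, 'e::euclidean_space) chart set \<Rightarrow> 'm tensor2 \<Rightarrow>
   'm \<Rightarrow> 'm covec \<Rightarrow> 'm tvec" where
  "metric_sharp A G p \<xi> = (THE v. v \<in> tangent_space A p \<and>
     (\<forall>w\<in>tangent_space A p. G p v w = \<xi> w))"

definition dual_metric ::
  "('m::{t2_space,second_countable_topology}, 'e::euclidean_space) chart set \<Rightarrow> 'm tensor2 \<Rightarrow>
   'm cotensor2" where
  "dual_metric A G = (\<lambda>p \<xi> \<eta>. G p (metric_sharp A G p \<xi>) (metric_sharp A G p \<eta>))"

text \<open>\<open>D \<alpha> \<beta>\<close> is $\nabla^\alpha\beta$.  The Koszul formula determines D on one-forms, because the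
  dual metric is nondegenerate; the values of D outside of \<open>one_forms A\<close> are irrelevant.\<close>

definition contravariant_levi_civita ::
  "('m::{t2_space,second_countable_topology}, 'e::euclidean_space) chart set \<Rightarrow> 'm cotensor2 \<Rightarrow>
   'm tensor2 \<Rightarrow> ('m form \<Rightarrow> 'm form \<Rightarrow> 'm form) \<Rightarrow> bool" where
  "contravariant_levi_civita A \<pi> G D \<longleftrightarrow>
     (\<forall>\<alpha>\<in>one_forms A. \<forall>\<beta>\<in>one_forms A. D \<alpha> \<beta> \<in> one_forms A \<and>
       (\<forall>\<gamma>\<in>one_forms A. \<forall>p.
          2 * dual_metric A G p (D \<alpha> \<beta> p) (\<gamma> p) =
              anchor A \<pi> \<alpha> p (\<lambda>q. dual_metric A G q (\<beta> q) (\<gamma> q))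
            + anchor A \<pi> \<beta> p (\<lambda>q. dual_metric A G q (\<alpha> q) (\<gamma> q))
            - anchor A \<pi> \<gamma> p (\<lambda>q. dual_metric A G q (\<alpha> q) (\<beta> q))
            + dual_metric A G p (koszul_bracket A \<pi> \<alpha> \<beta> p) (\<gamma> p)
            - dual_metric A G p (koszul_bracket A \<pi> \<alpha> \<gamma> p) (\<beta> p)
            - dual_metric A G p (koszul_bracket A \<pi> \<beta> \<gamma> p) (\<alpha> p)))"


section \<open>Kaehler-Poisson structures\<close>

text \<open>Smooth bundle maps of the cotangent bundle into itself, over the identity.\<close>

definition cotangent_bundle_map ::
  "('m::{t2_space,second_countable_topology}, 'e::euclidean_space) chart set \<Rightarrow>
   ('m \<Rightarrow> 'm covec \<Rightarrow> 'm covec) \<Rightarrow> bool" where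
  "cotangent_bundle_map A J \<longleftrightarrow>
     (\<forall>p. linear_endo_on (cotangent_space A p) (J p)) \<and>
     (\<forall>\<alpha>\<in>one_forms A. (\<lambda>p. J p (\<alpha> p)) \<in> one_forms A)"

definition apply_bundle_map :: "('m \<Rightarrow> 'm covec \<Rightarrow> 'm covec) \<Rightarrow> 'm form \<Rightarrow> 'm form" where
  "apply_bundle_map J \<alpha> = (\<lambda>p. J p (\<alpha> p))"

definition almost_kahler_poisson ::
  "('m::{t2_space,second_countable_topology}, 'e::euclidean_space) chart set \<Rightarrow> 'm cotensor2 \<Rightarrow>
   'm tensor2 \<Rightarrow> ('m \<Rightarrow> 'm covec \<Rightarrow> 'm covec) \<Rightarrow> bool" where
  "almost_kahler_poisson A \<pi> G J \<longleftrightarrow>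
     smooth_manifold A \<and> poisson_bivector A \<pi> \<and> pseudo_riemannian_metric A G \<and>
     cotangent_bundle_map A J \<and>
     (\<forall>p. \<forall>\<xi>\<in>cotangent_space A p. (\<lambda>v. J p (J p (J p \<xi>)) v + J p \<xi> v) = (\<lambda>v. 0)) \<and>
     (\<forall>\<alpha>\<in>one_forms A. \<forall>\<beta>\<in>one_forms A. \<forall>p.
        \<pi> p (\<alpha> p) (\<beta> p) = dual_metric A G p (\<alpha> p) (apply_bundle_map J \<beta> p))"

definition nabla_J ::
  "('m form \<Rightarrow> 'm form \<Rightarrow> 'm form) \<Rightarrow> ('m \<Rightarrow> 'm covec \<Rightarrow> 'm covec) \<Rightarrow>
   'm form \<Rightarrow> 'm form \<Rightarrow> 'm form" where
  "nabla_J D J \<alpha> \<beta> = (\<lambda>p v.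
     D \<alpha> (apply_bundle_map J \<beta>) p v - apply_bundle_map J (D \<alpha> \<beta>) p v)"

definition nabla_J_zero ::
  "('m::{t2_space,second_countable_topology}, 'e::euclidean_space) chart set \<Rightarrow>
   ('m form \<Rightarrow> 'm form \<Rightarrow> 'm form) \<Rightarrow> ('m \<Rightarrow> 'm covec \<Rightarrow> 'm covec) \<Rightarrow> bool" where
  "nabla_J_zero A D J \<longleftrightarrow>
     (\<forall>\<alpha>\<in>one_forms A. \<forall>\<beta>\<in>one_forms A. nabla_J D J \<alpha> \<beta> = (\<lambda>p v. 0))"

text \<open>Here D is meant to be the contravariant Levi-Civita connection of \<open>\<pi>\<close> and G.\<close>

definition kahler_poisson ::
  "('m::{t2_space,second_countable_topology}, 'e::euclidean_space) chart set \<Rightarrow> 'm cotensor2 \<Rightarrow>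
   'm tensor2 \<Rightarrow> ('m \<Rightarrow> 'm covec \<Rightarrow> 'm covec) \<Rightarrow> ('m form \<Rightarrow> 'm form \<Rightarrow> 'm form) \<Rightarrow> bool" where
  "kahler_poisson A \<pi> G J D \<longleftrightarrow>
     almost_kahler_poisson A \<pi> G J \<and> contravariant_levi_civita A \<pi> G D \<and> nabla_J_zero A D J"

definition nabla_pi ::
  "('m::{t2_space,second_countable_topology}, 'e::euclidean_space) chart set \<Rightarrow> 'm cotensor2 \<Rightarrow>
   ('m form \<Rightarrow> 'm form \<Rightarrow> 'm form) \<Rightarrow> 'm form \<Rightarrow> 'm form \<Rightarrow> 'm form \<Rightarrow> 'm \<Rightarrow> real" where
  "nabla_pi A \<pi> D \<alpha> \<beta> \<gamma> = (\<lambda>p.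
     anchor A \<pi> \<alpha> p (\<lambda>q. \<pi> q (\<beta> q) (\<gamma> q))
   - \<pi> p (D \<alpha> \<beta> p) (\<gamma> p) - \<pi> p (\<beta> p) (D \<alpha> \<gamma> p))"

definition nijenhuis ::
  "('m::{t2_space,second_countable_topology}, 'e::euclidean_space) chart set \<Rightarrow> 'm cotensor2 \<Rightarrow>
   ('m \<Rightarrow> 'm covec \<Rightarrow> 'm covec) \<Rightarrow> 'm form \<Rightarrow> 'm form \<Rightarrow> 'm form" where
  "nijenhuis A \<pi> J \<alpha> \<beta> = (\<lambda>p v.
     koszul_bracket A \<pi> (apply_bundle_map J \<alpha>) (apply_bundle_map J \<beta>) p v
   + apply_bundle_map J (apply_bundle_map J (koszul_bracket A \<pi> \<alpha> \<beta>)) p v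
   - apply_bundle_map J (\<lambda>q w. koszul_bracket A \<pi> \<alpha> (apply_bundle_map J \<beta>) q w
                             + koszul_bracket A \<pi> (apply_bundle_map J \<alpha>) \<beta> q w) p v)"

end

theory Submission
  imports Defs
begin

text \<open>Everything follows from two properties of the connection D: it is compatible with the dual
  metric and its torsion vanishes, the bracket being \<open>D \<alpha> \<beta> - D \<beta> \<alpha>\<close>.  Both come from
  the Koszul formula and the antisymmetry of the bracket (\<open>metric_compatible\<close>, \<open>torsion_free\<close>).  Metric
  compatibility shows that the derivative of \<open>\<pi>\<close> in the arguments \<open>\<alpha>, \<beta>, \<gamma>\<close> is the inner product of \<open>\<beta>\<close>
  with the derivative of J in the arguments \<open>\<alpha>, \<gamma>\<close> (\<open>nabla_pi_eq_nabla_J\<close>), so by nondegeneracy one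
  vanishes if and only if the other does.  Vanishing torsion turns the brackets of the Nijenhuis tensor
  into covariant derivatives, which regroup into derivatives of J (\<open>nijenhuis_eq_nabla_J\<close>).

  The real work is to show that the objects in these formulas exist.  The anchor, the
  index-raising of the metric and the Lie derivative are definite descriptions over spaces of derivations
  of the algebra of globally defined smooth functions, and they denote what they should only if tangent
  spaces are finite-dimensional, tangent vectors and covectors extend to global vector fields and
  one-forms, and function-linear maps on vector fields are one-forms.  All of this is drawn from one
  statement (\<open>frame_exists\<close>): around every point there are global functions $x_b$, global vector fields $E_b$
  and a cut-off \<open>\<kappa>\<close>, equal to 1 at the point, such that $\<kappa> v = \<Sum>_b v(x_b) E_b$ for all tangent
  vectors v of the manifold.  Its proof combines bump functions with Hadamard's lemma in a chart.  The
  sharp map of the metric then exists because an injective endomorphism of the model space is surjective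
  (\<open>metric_surjective\<close>), and the Lie derivative exists by the tensor characterization lemma
  (\<open>tensorial_is_one_form\<close>).\<close>

section \<open>Calculus of maps of class $C^k$\<close>

lemma frechet_derivative_eqI:
  assumes "(f has_derivative f') (at x)"
  shows "frechet_derivative f (at x) = f'"
  using frechet_derivative_at[OF assms] by simp

lemma frechet_derivative_cong_open:
  assumes "open S" "x \<in> S" "\<And>y. y \<in> S \<Longrightarrow> f y = g y" "f differentiable (at x)"
  shows "g differentiable (at x)" "frechet_derivative g (at x) = frechet_derivative f (at x)"
proof -
  have "(g has_derivative frechet_derivative f (at x)) (at x)"
    by (rule has_derivative_transform_within_open[of f])
       (use assms frechet_derivative_works in auto)
  then show "g differentiable (at x)" "frechet_derivative g (at x) = frechet_derivative f (at x)"
    by (auto simp: differentiable_def frechet_derivative_eqI)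
qed

lemma Ck_on_cong:
  assumes "open S" "\<And>x. x \<in> S \<Longrightarrow> f x = g x" "Ck_on k S f"
  shows "Ck_on k S g"
  using assms(2,3)
proof (induction k arbitrary: f g)
  case 0
  then show ?case using continuous_on_cong by force
next
  case (Suc k)
  have d: "f differentiable (at x)" if "x \<in> S" for x
    using Suc.prems(2) that by simp
  have e: "g differentiable (at x)" "frechet_derivative g (at x) = frechet_derivative f (at x)"
    if "x \<in> S" for x
    using frechet_derivative_cong_open[OF assms(1) that Suc.prems(1) d[OF that]] by auto
  have "Ck_on k S (\<lambda>x. frechet_derivative g (at x) v)" for v
    by (rule Suc.IH[of "\<lambda>x. frechet_derivative f (at x) v"]) (use e Suc.prems(2) in auto)
  then show ?case using e by simp
qed

lemma Ck_on_SucI: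
  assumes "open S" "\<And>x. x \<in> S \<Longrightarrow> (f has_derivative f' x) (at x)"
    "\<And>v. Ck_on k S (\<lambda>x. f' x v)"
  shows "Ck_on (Suc k) S f"
proof -
  have "Ck_on k S (\<lambda>x. frechet_derivative f (at x) v)" for v
    by (rule Ck_on_cong[OF assms(1) _ assms(3)[of v]])
       (simp add: frechet_derivative_eqI[OF assms(2)])
  then show ?thesis using assms(2) by (auto simp: differentiable_def)
qed

lemma Ck_on_SucD:
  assumes "Ck_on (Suc k) S f" "x \<in> S"
  shows "(f has_derivative frechet_derivative f (at x)) (at x)"
  using assms frechet_derivative_works by auto

lemma Ck_on_Suc_imp: "Ck_on (Suc k) S f \<Longrightarrow> Ck_on k S f"
proof (induction k arbitrary: f)
  case 0
  then show ?case
    by (simp add: continuous_at_imp_continuous_on differentiable_imp_continuous_within)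
next
  case (Suc k)
  then show ?case by (metis Ck_on.simps(2))
qed

lemma Ck_on_imp_continuous_on: "Ck_on k S f \<Longrightarrow> continuous_on S f"
  by (induction k) (auto dest: Ck_on_Suc_imp simp del: Ck_on.simps(2))

lemma Ck_on_subset: "Ck_on k S f \<Longrightarrow> T \<subseteq> S \<Longrightarrow> Ck_on k T f"
proof (induction k arbitrary: f)
  case 0
  then show ?case by (auto intro: continuous_on_subset)
next
  case (Suc k)
  then show ?case by (metis Ck_on.simps(2) subsetD)
qed

lemma Ck_on_local:
  assumes "\<And>x. x \<in> S \<Longrightarrow> \<exists>T. open T \<and> x \<in> T \<and> Ck_on k T f"
  shows "Ck_on k S f"
  using assms
proof (induction k arbitrary: f)
  case 0
  then show ?case
    by simp (metis continuous_at_imp_continuous_on continuous_on_eq_continuous_at)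
next
  case (Suc k)
  have "Ck_on k S (\<lambda>x. frechet_derivative f (at x) v)" for v
    by (rule Suc.IH) (use Suc.prems in \<open>metis Ck_on.simps(2)\<close>)
  moreover have "f differentiable (at x)" if "x \<in> S" for x
    using Suc.prems[OF that] by auto
  ultimately show ?case by simp
qed

lemma Ck_on_const: "Ck_on k S (\<lambda>x. c)"
proof (induction k arbitrary: c)
  case (Suc k)
  then show ?case by simp
qed simp

lemma Ck_on_linear:
  assumes "open S" "bounded_linear L"
  shows "Ck_on k S L"
proof (cases k)
  case 0
  then show ?thesis by (simp add: linear_continuous_on assms)
next
  case (Suc j)
  show ?thesis unfolding Suc
    by (rule Ck_on_SucI[OF assms(1), of L "\<lambda>x. L"])
       (auto intro: bounded_linear_imp_has_derivative assms Ck_on_const)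
qed

lemma Ck_on_add:
  assumes "open S" "Ck_on k S f" "Ck_on k S g"
  shows "Ck_on k S (\<lambda>x. f x + g x)"
  using assms(2,3)
proof (induction k arbitrary: f g)
  case 0
  then show ?case by (simp add: continuous_on_add)
next
  case (Suc k)
  show ?case
    by (rule Ck_on_SucI[OF assms(1)])
       (use Suc in \<open>auto intro!: has_derivative_add Ck_on_SucD[OF Suc.prems(1)] Ck_on_SucD[OF Suc.prems(2)]\<close>)
qed

lemma Ck_on_sum:
  assumes "open S" "\<And>i. i \<in> I \<Longrightarrow> Ck_on k S (f i)"
  shows "Ck_on k S (\<lambda>x. \<Sum>i\<in>I. f i x)"
  using assms(2)
  by (induction I rule: infinite_finite_induct) (auto intro: Ck_on_const Ck_on_add assms(1))

lemma Ck_on_linear_comp: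
  assumes "open S" "bounded_linear L" "Ck_on k S f"
  shows "Ck_on k S (\<lambda>x. L (f x))"
  using assms(3)
proof (induction k arbitrary: f)
  case 0
  then show ?case by (simp add: assms bounded_linear.continuous_on)
next
  case (Suc k)
  show ?case
    by (rule Ck_on_SucI[OF assms(1)])
       (use Suc in \<open>auto intro!: bounded_linear.has_derivative[OF assms(2)] Ck_on_SucD[OF Suc.prems]\<close>)
qed

lemma Ck_on_scaleR:
  assumes "open S" "Ck_on k S f" "Ck_on k S g"
  shows "Ck_on k S (\<lambda>x. f x *\<^sub>R g x)"
  using assms(2,3)
proof (induction k arbitrary: f g)
  case 0
  then show ?case by (simp add: continuous_on_scaleR)
next
  case (Suc k)
  let ?f' = "\<lambda>x. frechet_derivative f (at x)" and ?g' = "\<lambda>x. frechet_derivative g (at x)"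
  have "Ck_on k S (\<lambda>x. f x *\<^sub>R ?g' x v + ?f' x v *\<^sub>R g x)" for v
    by (intro Ck_on_add[OF assms(1)] Suc.IH Ck_on_Suc_imp[OF Suc.prems(1)] Ck_on_Suc_imp[OF Suc.prems(2)])
       (use Suc.prems in auto)
  then show ?case
    by (intro Ck_on_SucI[OF assms(1) has_derivative_scaleR[OF Ck_on_SucD[OF Suc.prems(1)] Ck_on_SucD[OF Suc.prems(2)]]])
qed

text \<open>The derivative of a composition is rewritten in coordinates, as a sum of products of
  compositions, so that the induction hypothesis and the product rule apply to it.\<close>

lemma Ck_on_compose:
  fixes f :: "'a::euclidean_space \<Rightarrow> 'b::euclidean_space" and g :: "'b \<Rightarrow> 'c::euclidean_space"
  assumes "open S" "open T" "\<And>x. x \<in> S \<Longrightarrow> f x \<in> T" "Ck_on k S f" "Ck_on k T g"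
  shows "Ck_on k S (\<lambda>x. g (f x))"
  using assms(4,5)
proof (induction k arbitrary: g)
  case 0
  then show ?case using assms(3) by (auto intro: continuous_on_compose2)
next
  case (Suc k)
  let ?g' = "\<lambda>y. frechet_derivative g (at y)" and ?f' = "\<lambda>x. frechet_derivative f (at x)"
  have g': "(g has_derivative ?g' (f x)) (at (f x))" if "x \<in> S" for x
    using Ck_on_SucD[OF Suc.prems(2)] assms(3) that by auto
  have "Ck_on k S (\<lambda>x. \<Sum>b\<in>Basis. (?f' x v \<bullet> b) *\<^sub>R ?g' (f x) b)" for v
    by (intro Ck_on_sum Ck_on_scaleR assms(1) Suc.IH
          Ck_on_linear_comp[OF _ bounded_linear_inner_left])
       (use Suc.prems Ck_on_Suc_imp in auto)
  moreover have "(\<Sum>b\<in>Basis. (?f' x v \<bullet> b) *\<^sub>R ?g' (f x) b) = ?g' (f x) (?f' x v)"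
    if "x \<in> S" for x v
  proof -
    have "?g' (f x) (?f' x v) = ?g' (f x) (\<Sum>b\<in>Basis. (?f' x v \<bullet> b) *\<^sub>R b)"
      by (simp add: euclidean_representation)
    also have "\<dots> = (\<Sum>b\<in>Basis. (?f' x v \<bullet> b) *\<^sub>R ?g' (f x) b)"
      using has_derivative_linear[OF g'[OF that]] by (simp add: linear_sum linear_cmul)
    finally show ?thesis by simp
  qed
  ultimately have "Ck_on k S (\<lambda>x. ?g' (f x) (?f' x v))" for v
    by (rule Ck_on_cong[OF assms(1), rotated])
  moreover have "((\<lambda>x. g (f x)) has_derivative (\<lambda>v. ?g' (f x) (?f' x v))) (at x)" if "x \<in> S" for x
    by (rule has_derivative_compose[OF Ck_on_SucD[OF Suc.prems(1) that] g'[OF that]])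
  ultimately show ?case by (rule Ck_on_SucI[OF assms(1), rotated])
qed

lemma smooth_on_cong:
  "open S \<Longrightarrow> (\<And>x. x \<in> S \<Longrightarrow> f x = g x) \<Longrightarrow> smooth_on S f \<Longrightarrow> smooth_on S g"
  unfolding smooth_on_def using Ck_on_cong by blast

lemma smooth_on_subset: "smooth_on S f \<Longrightarrow> T \<subseteq> S \<Longrightarrow> smooth_on T f"
  unfolding smooth_on_def using Ck_on_subset by blast

lemma smooth_on_local:
  assumes "\<And>x. x \<in> S \<Longrightarrow> \<exists>T. open T \<and> x \<in> T \<and> smooth_on T f"
  shows "smooth_on S f"
  unfolding smooth_on_def
proof
  fix k
  show "Ck_on k S f"
    by (rule Ck_on_local) (use assms in \<open>auto simp: smooth_on_def\<close>)
qed

lemma smooth_on_const: "smooth_on S (\<lambda>x. c)"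
  by (simp add: smooth_on_def Ck_on_const)

lemma smooth_on_linear: "open S \<Longrightarrow> bounded_linear L \<Longrightarrow> smooth_on S L"
  by (simp add: smooth_on_def Ck_on_linear)

lemma smooth_on_add:
  "open S \<Longrightarrow> smooth_on S f \<Longrightarrow> smooth_on S g \<Longrightarrow> smooth_on S (\<lambda>x. f x + g x)"
  by (simp add: smooth_on_def Ck_on_add)

lemma smooth_on_mult:
  fixes f g :: "'a::euclidean_space \<Rightarrow> real"
  shows "open S \<Longrightarrow> smooth_on S f \<Longrightarrow> smooth_on S g \<Longrightarrow> smooth_on S (\<lambda>x. f x * g x)"
  unfolding smooth_on_def using Ck_on_scaleR[of S _ f g] by simp

lemma smooth_on_diff:
  fixes f g :: "'a::euclidean_space \<Rightarrow> real"
  assumes "open S" "smooth_on S f" "smooth_on S g"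
  shows "smooth_on S (\<lambda>x. f x - g x)"
  using smooth_on_add[OF assms(1,2) smooth_on_mult[OF assms(1) smooth_on_const assms(3), of "-1"]]
  by simp

lemma smooth_on_compose:
  "open S \<Longrightarrow> open T \<Longrightarrow> (\<And>x. x \<in> S \<Longrightarrow> f x \<in> T) \<Longrightarrow> smooth_on S f \<Longrightarrow> smooth_on T g \<Longrightarrow>
    smooth_on S (\<lambda>x. g (f x))"
  by (simp add: smooth_on_def Ck_on_compose)

lemma smooth_on_derivative:
  assumes "smooth_on S f"
  shows "smooth_on S (\<lambda>x. frechet_derivative f (at x) v)"
  unfolding smooth_on_def
proof
  fix k
  from assms have "Ck_on (Suc k) S f" unfolding smooth_on_def by blast
  then show "Ck_on k S (\<lambda>x. frechet_derivative f (at x) v)" by simp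
qed

lemma smooth_on_has_derivative:
  assumes "smooth_on S f" "x \<in> S"
  shows "(f has_derivative frechet_derivative f (at x)) (at x)"
  using assms Ck_on_SucD[of 0] unfolding smooth_on_def by blast

lemma smooth_on_imp_continuous_on: "smooth_on S f \<Longrightarrow> continuous_on S f"
  unfolding smooth_on_def by (metis Ck_on.simps(1))

section \<open>Bump functions\<close>

text \<open>The classical function $e^{-1/t}$, extended by 0 to $t \<le> 0$, multiplied by $t^{-n}$.  The
  derivatives of $e^{-1/t}$ are combinations of these functions, so the whole family is carried
  through the induction on the order of differentiability.\<close>

definition flat :: "nat \<Rightarrow> real \<Rightarrow> real" where
  "flat n t = (if t > 0 then inverse t ^ n * exp (- inverse t) else 0)"

text \<open>This one limit, for all n, gives both the continuity of \<open>flat n\<close> at 0 and its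
  differentiability there, because the difference quotient of \<open>flat n\<close> at 0 is \<open>flat (n + 1)\<close>.\<close>

lemma flat_tendsto_0: "(flat n \<longlongrightarrow> 0) (at 0)"
proof -
  have "((\<lambda>t. inverse t ^ n / exp (inverse t)) \<longlongrightarrow> 0) (at_right (0::real))"
    by (rule filterlim_compose[OF tendsto_power_div_exp_0 filterlim_inverse_at_top_right])
  then have R: "(flat n \<longlongrightarrow> 0) (at_right 0)"
    by (rule Lim_transform_eventually)
       (auto simp: eventually_at_filter flat_def exp_minus field_simps)
  have L: "(flat n \<longlongrightarrow> 0) (at_left 0)"
    by (rule Lim_transform_eventually[OF tendsto_const])
       (auto simp: eventually_at_filter flat_def)
  show ?thesis using L R by (simp add: filterlim_split_at_real)
qed

lemma flat_has_derivative:
  "(flat n has_real_derivative (flat (n + 2) t - real n * flat (n + 1) t)) (at t)"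
proof (cases t "0::real" rule: linorder_cases)
  case less
  have "((\<lambda>t. 0) has_real_derivative 0) (at t)" by simp
  then have "(flat n has_real_derivative 0) (at t)"
    by (rule has_field_derivative_transform_within_open[of _ _ _ "{..<0}"])
       (use less in \<open>auto simp: flat_def\<close>)
  then show ?thesis using less by (simp add: flat_def)
next
  case equal
  have "((\<lambda>h. (flat n h - flat n 0) / (h - 0)) \<longlongrightarrow> 0) (at 0)"
    by (rule Lim_transform_eventually[OF flat_tendsto_0[of "Suc n"]])
       (auto simp: flat_def eventually_at_filter field_simps)
  then show ?thesis unfolding equal
    by (simp add: has_field_derivative_iff flat_def)
next
  case greater
  define u where "u = inverse t"
  have i: "(inverse has_real_derivative - (u * u)) (at t)"
    using DERIV_inverse[of t] greater by (simp add: u_def)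
  have e: "((\<lambda>t. exp (- inverse t)) has_real_derivative exp (- u) * (u * u)) (at t)"
    using DERIV_fun_exp[OF DERIV_minus[OF i]] by (simp add: u_def)
  have "((\<lambda>t. inverse t ^ n * exp (- inverse t)) has_real_derivative
      (real n * u ^ (n - 1) * (- (u * u))) * exp (- u) + u ^ n * (exp (- u) * (u * u))) (at t)"
    using DERIV_mult[OF DERIV_power[OF i, of n] e] by (simp add: u_def mult_ac)
  also have "(real n * u ^ (n - 1) * (- (u * u))) * exp (- u) + u ^ n * (exp (- u) * (u * u)) =
      u ^ (n + 2) * exp (- u) - real n * (u ^ (n + 1) * exp (- u))"
    by (cases n) (simp_all add: algebra_simps)
  finally have "((\<lambda>t. inverse t ^ n * exp (- inverse t)) has_real_derivative
      (inverse t ^ (n+2) * exp (- inverse t) - real n * (inverse t ^ (n+1) * exp (- inverse t)))) (at t)"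
    unfolding u_def .
  then have "(flat n has_real_derivative
      (inverse t ^ (n+2) * exp (- inverse t) - real n * (inverse t ^ (n+1) * exp (- inverse t)))) (at t)"
    by (rule has_field_derivative_transform_within_open[of _ _ _ "{0<..}"])
       (use greater in \<open>auto simp: flat_def\<close>)
  then show ?thesis using greater by (simp add: flat_def)
qed

lemma Ck_on_realI:
  fixes f :: "real \<Rightarrow> real"
  assumes "open S" "\<And>t. t \<in> S \<Longrightarrow> (f has_real_derivative f' t) (at t)" "Ck_on k S f'"
  shows "Ck_on (Suc k) S f"
proof (rule Ck_on_SucI[OF assms(1)])
  show "(f has_derivative (\<lambda>v. v *\<^sub>R f' t)) (at t)" if "t \<in> S" for t
    using assms(2)[OF that] by (simp add: has_field_derivative_def mult.commute[of _ "f' t"])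
  show "Ck_on k S (\<lambda>t. v *\<^sub>R f' t)" for v
    by (rule Ck_on_scaleR[OF assms(1) Ck_on_const assms(3)])
qed

lemma Ck_on_flat: "Ck_on k UNIV (flat n)"
proof (induction k arbitrary: n)
  case 0
  show ?case
    using flat_has_derivative DERIV_isCont by (simp add: continuous_on_eq_continuous_at) blast
next
  case (Suc k)
  have "Ck_on k UNIV (\<lambda>t. flat (n + 2) t + (- real n) *\<^sub>R flat (n + 1) t)"
    by (intro Ck_on_add Ck_on_scaleR Suc Ck_on_const open_UNIV)
  then have "Ck_on k UNIV (\<lambda>t. flat (n + 2) t - real n * flat (n + 1) t)" by simp
  then show ?case by (rule Ck_on_realI[OF open_UNIV flat_has_derivative])
qed

lemma smooth_on_inverse: "smooth_on {0<..} (inverse :: real \<Rightarrow> real)"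
  unfolding smooth_on_def
proof
  fix k
  show "Ck_on k {0<..} (inverse :: real \<Rightarrow> real)"
  proof (induction k)
    case 0
    show ?case by (auto intro!: continuous_intros)
  next
    case (Suc k)
    show ?case
    proof (rule Ck_on_realI)
      show "(inverse has_real_derivative ((-1) *\<^sub>R (inverse t *\<^sub>R inverse t))) (at t)" if "t \<in> {0<..}" for t :: real
        using that by (auto intro!: derivative_eq_intros)
      show "Ck_on k {0<..} (\<lambda>t::real. (-1) *\<^sub>R (inverse t *\<^sub>R inverse t))"
        by (intro Ck_on_scaleR Suc Ck_on_const) auto
    qed auto
  qed
qed

text \<open>The denominator never vanishes: for every t one of t and 1 - t is positive.\<close>

definition smooth_step :: "real \<Rightarrow> real" where
  "smooth_step t = flat 0 t * inverse (flat 0 t + flat 0 (1 - t))"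

lemma smooth_step_simps: "t \<le> 0 \<Longrightarrow> smooth_step t = 0" "t \<ge> 1 \<Longrightarrow> smooth_step t = 1"
  by (auto simp: smooth_step_def flat_def)

lemma smooth_on_smooth_step: "smooth_on UNIV smooth_step"
proof -
  have f: "smooth_on UNIV (flat 0)" by (simp add: smooth_on_def Ck_on_flat)
  have id: "smooth_on UNIV (\<lambda>t::real. t)" by (simp add: smooth_on_linear)
  have f1: "smooth_on UNIV (\<lambda>t. flat 0 (1 - t))"
    by (intro smooth_on_compose[OF open_UNIV open_UNIV _ _ f] smooth_on_diff smooth_on_const id) auto
  have "smooth_on UNIV (\<lambda>t. inverse (flat 0 t + flat 0 (1 - t)))"
    by (rule smooth_on_compose[OF _ _ _ smooth_on_add[OF _ f f1] smooth_on_inverse])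
       (auto simp: flat_def add_pos_pos)
  then have "smooth_on UNIV (\<lambda>t. flat 0 t * inverse (flat 0 t + flat 0 (1 - t)))"
    by (intro smooth_on_mult f) auto
  then show ?thesis by (simp add: smooth_step_def[abs_def])
qed

text \<open>A smooth step is applied to a quadratic polynomial in the distance from x, normalized to be at
  least 1 on the inner ball and at most 0 off the outer one.\<close>

lemma bump_function:
  fixes x :: "'e::euclidean_space"
  assumes "0 < r" "r < s"
  obtains \<rho> :: "'e \<Rightarrow> real" where "smooth_on UNIV \<rho>" "\<And>z. z \<in> cball x r \<Longrightarrow> \<rho> z = 1"
    "\<And>z. z \<notin> ball x s \<Longrightarrow> \<rho> z = 0"
proof
  let ?a = "\<lambda>z. (s\<^sup>2 - (z - x) \<bullet> (z - x)) * inverse (s\<^sup>2 - r\<^sup>2)"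
  have pos: "0 < s\<^sup>2 - r\<^sup>2" using assms by (simp add: power_strict_mono)
  have q: "smooth_on UNIV (\<lambda>z::'e. (z - x) \<bullet> (z - x))"
    unfolding smooth_on_def
  proof
    fix k
    have "Ck_on (Suc k) UNIV (\<lambda>z::'e. (z - x) \<bullet> (z - x))"
    proof (rule Ck_on_SucI)
      show "((\<lambda>z. (z - x) \<bullet> (z - x)) has_derivative (\<lambda>v. v \<bullet> (2 *\<^sub>R z) + - (2 * (x \<bullet> v)))) (at z)" for z
        by (auto intro!: derivative_eq_intros simp: inner_diff_left inner_diff_right inner_commute algebra_simps)
      show "Ck_on k UNIV (\<lambda>z. v \<bullet> (2 *\<^sub>R z) + - (2 * (x \<bullet> v)))" for v
        by (intro Ck_on_add Ck_on_const Ck_on_linear open_UNIV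
            bounded_linear_compose[OF bounded_linear_inner_right bounded_linear_scaleR_right])
    qed auto
    then show "Ck_on k UNIV (\<lambda>z::'e. (z - x) \<bullet> (z - x))" by (rule Ck_on_Suc_imp)
  qed
  have "smooth_on UNIV ?a"
    by (intro smooth_on_mult smooth_on_diff q smooth_on_const open_UNIV)
  then show "smooth_on UNIV (\<lambda>z. smooth_step (?a z))"
    by (intro smooth_on_compose[OF open_UNIV open_UNIV _ _ smooth_on_smooth_step]) auto
  show "smooth_step (?a z) = 1" if "z \<in> cball x r" for z
  proof -
    have "(z - x) \<bullet> (z - x) \<le> r\<^sup>2"
      using that assms by (simp add: dist_norm norm_minus_commute dot_square_norm power_mono)
    then show ?thesis using pos by (intro smooth_step_simps) (simp add: field_simps)
  qed
  show "smooth_step (?a z) = 0" if "z \<notin> ball x s" for z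
  proof -
    have "s\<^sup>2 \<le> (z - x) \<bullet> (z - x)"
      using that assms by (simp add: dist_norm norm_minus_commute dot_square_norm power_mono)
    then show ?thesis using pos by (intro smooth_step_simps) (simp add: field_simps)
  qed
qed

section \<open>Hadamard's lemma\<close>

text \<open>Differentiation under the integral sign: the derivative in direction v is the same kind of
  integral, with F replaced by its derivative and m by m + 1.  The weight $t^m$ is there to absorb the
  factor t that the chain rule produces.\<close>

lemma Ck_on_radial_integral:
  fixes F :: "'e::euclidean_space \<Rightarrow> real"
  assumes S: "open S" "convex S" "y \<in> S"
  shows "Ck_on k S F \<Longrightarrow> Ck_on k S (\<lambda>z. integral (cbox 0 1) (\<lambda>t. t ^ m * F (y + t *\<^sub>R (z - y))))"
proof (induction k arbitrary: F m)
  case 0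
  have in_S: "y + t *\<^sub>R (z - y) \<in> S" if "z \<in> S" "t \<in> cbox 0 1" for z t
    using convexD_alt[OF S(2,3) that(1), of t] that(2) by (simp add: algebra_simps)
  have "continuous_on (S \<times> cbox 0 1) (\<lambda>(z, t). t ^ m * F (y + t *\<^sub>R (z - y)))"
    unfolding split_def
    by (intro continuous_intros continuous_on_compose2[OF 0[simplified]]) (auto simp: in_S)
  from integral_continuous_on_param[OF this] show ?case by simp
next
  case (Suc k)
  have in_S: "y + t *\<^sub>R (z - y) \<in> S" if "z \<in> S" "t \<in> cbox 0 1" for z t
    using convexD_alt[OF S(2,3) that(1), of t] that(2) by (simp add: algebra_simps)
  define F' where "F' = (\<lambda>z. frechet_derivative F (at z))"
  have F': "(F has_derivative F' z) (at z)" if "z \<in> S" for z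
    unfolding F'_def using Ck_on_SucD[OF Suc.prems that] .
  have bl: "bounded_linear (F' z)" if "z \<in> S" for z
    using F'[OF that] by (rule has_derivative_bounded_linear)
  have CF': "Ck_on k S (\<lambda>z. F' z v)" for v using Suc.prems by (simp add: F'_def)
  have contF': "continuous_on S (\<lambda>z. F' z v)" for v
    by (rule Ck_on_imp_continuous_on[OF CF'])
  define dF where "dF = (\<lambda>z t. Blinfun (\<lambda>v. t ^ Suc m * F' (y + t *\<^sub>R (z - y)) v))"
  have dF: "blinfun_apply (dF z t) = (\<lambda>v. t ^ Suc m * F' (y + t *\<^sub>R (z - y)) v)"
    if "z \<in> S" "t \<in> cbox 0 1" for z t
    unfolding dF_def
    by (intro bounded_linear_Blinfun_apply bounded_linear_const_mult bl in_S that)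
  have contdF: "continuous_on (S \<times> cbox 0 1) (\<lambda>(z, t). dF z t)"
    unfolding split_def
  proof (rule continuous_on_blinfun_componentwise)
    fix b :: 'e
    have "continuous_on (S \<times> cbox 0 1) (\<lambda>x. snd x ^ Suc m * F' (y + snd x *\<^sub>R (fst x - y)) b)"
      by (intro continuous_intros continuous_on_compose2[OF contF'[of b]]) (auto simp: in_S)
    then show "continuous_on (S \<times> cbox 0 1) (\<lambda>x. blinfun_apply (dF (fst x) (snd x)) b)"
      by (rule continuous_on_eq) (auto simp: dF)
  qed
  have contF: "continuous_on S F" by (rule Ck_on_imp_continuous_on[OF Suc.prems])
  have D: "((\<lambda>z. integral (cbox 0 1) (\<lambda>t. t ^ m * F (y + t *\<^sub>R (z - y)))) has_derivative
      blinfun_apply (integral (cbox 0 1) (dF z))) (at z)" if z: "z \<in> S" for z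
  proof -
    have "((\<lambda>z. integral (cbox 0 1) (\<lambda>t. t ^ m * F (y + t *\<^sub>R (z - y)))) has_derivative
      blinfun_apply (integral (cbox 0 1) (dF z))) (at z within S)"
    proof (rule leibniz_rule[OF _ _ contdF z S(2)])
      fix z t assume z: "z \<in> S" and t: "t \<in> cbox (0::real) 1"
      have "((\<lambda>z. y + t *\<^sub>R (z - y)) has_derivative (\<lambda>v. t *\<^sub>R v)) (at z)"
        by (auto intro!: derivative_eq_intros)
      from has_derivative_compose[OF this F'[OF in_S[OF z t]]]
      have "((\<lambda>z. F (y + t *\<^sub>R (z - y))) has_derivative (\<lambda>v. F' (y + t *\<^sub>R (z - y)) (t *\<^sub>R v))) (at z)" .
      then have "((\<lambda>z. t ^ m * F (y + t *\<^sub>R (z - y))) has_derivative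
          (\<lambda>v. t ^ m * F' (y + t *\<^sub>R (z - y)) (t *\<^sub>R v))) (at z)"
        by (rule has_derivative_mult_right)
      also have "(\<lambda>v. t ^ m * F' (y + t *\<^sub>R (z - y)) (t *\<^sub>R v)) = blinfun_apply (dF z t)"
        using linear_cmul[OF bounded_linear.linear[OF bl[OF in_S[OF z t]]]]
        by (simp add: dF[OF z t] mult_ac)
      finally show "((\<lambda>z. t ^ m * F (y + t *\<^sub>R (z - y))) has_derivative blinfun_apply (dF z t)) (at z within S)"
        by (rule has_derivative_at_withinI)
    next
      fix z assume z: "z \<in> S"
      show "(\<lambda>t. t ^ m * F (y + t *\<^sub>R (z - y))) integrable_on cbox 0 1"
        by (intro integrable_continuous continuous_intros continuous_on_compose2[OF contF])
           (auto simp: in_S[OF z])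
    qed
    then show ?thesis using at_within_open[OF z S(1)] by simp
  qed
  have I: "blinfun_apply (integral (cbox 0 1) (dF z)) v =
      integral (cbox 0 1) (\<lambda>t. t ^ Suc m * F' (y + t *\<^sub>R (z - y)) v)" if z: "z \<in> S" for z v
  proof -
    have "continuous_on (cbox 0 1) (\<lambda>t. case (z, t) of (z, t) \<Rightarrow> dF z t)"
      by (rule continuous_on_compose2[OF contdF])
         (use z in \<open>auto intro!: continuous_on_Pair continuous_on_const continuous_on_id\<close>)
    then have "continuous_on (cbox 0 1) (dF z)" by simp
    then have "blinfun_apply (integral (cbox 0 1) (dF z)) v = integral (cbox 0 1) (\<lambda>t. blinfun_apply (dF z t) v)"
      by (intro blinfun_apply_integral integrable_continuous)
    also have "\<dots> = integral (cbox 0 1) (\<lambda>t. t ^ Suc m * F' (y + t *\<^sub>R (z - y)) v)"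
      by (rule integral_cong) (simp add: dF[OF z])
    finally show ?thesis .
  qed
  show ?case
  proof (rule Ck_on_SucI[OF S(1) D])
    show "Ck_on k S (\<lambda>z. blinfun_apply (integral (cbox 0 1) (dF z)) v)" for v
      by (rule Ck_on_cong[OF S(1) _ Suc.IH[OF CF', of "Suc m" v]]) (simp only: I)
  qed
qed

text \<open>The fundamental theorem of calculus along the segment from y to z, where the coefficient \<open>g b\<close> is
  the mean of the b-th partial derivative over that segment.  Plain Taylor expansion would not do: the
  coefficients have to be smooth, since derivations are going to be applied to them.\<close>

lemma hadamard_lemma:
  fixes F :: "'e::euclidean_space \<Rightarrow> real"
  assumes S: "open S" "convex S" "y \<in> S" and F: "smooth_on S F"
  obtains g :: "'e \<Rightarrow> 'e \<Rightarrow> real" where "\<And>b. smooth_on S (g b)"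
    "\<And>b. g b y = frechet_derivative F (at y) b"
    "\<And>z. z \<in> S \<Longrightarrow> F z = F y + (\<Sum>b\<in>Basis. ((z - y) \<bullet> b) * g b z)"
proof
  define F' where "F' = (\<lambda>z. frechet_derivative F (at z))"
  have in_S: "y + t *\<^sub>R (z - y) \<in> S" if "z \<in> S" "t \<in> {0..1}" for z t
    using convexD_alt[OF S(2,3) that(1), of t] that(2) by (simp add: algebra_simps)
  have F': "(F has_derivative F' z) (at z)" if "z \<in> S" for z
    unfolding F'_def using smooth_on_has_derivative[OF F that] .
  have smF': "smooth_on S (\<lambda>z. F' z b)" for b
    unfolding F'_def by (rule smooth_on_derivative[OF F])
  let ?g = "\<lambda>b z. integral (cbox 0 1) (\<lambda>t. F' (y + t *\<^sub>R (z - y)) b)"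
  show "smooth_on S (?g b)" for b
    using Ck_on_radial_integral[OF S, of _ "\<lambda>z. F' z b" 0] smF'[of b] by (simp add: smooth_on_def)
  show "?g b y = frechet_derivative F (at y) b" for b
    by (simp add: F'_def)
  show "F z = F y + (\<Sum>b\<in>Basis. ((z - y) \<bullet> b) * ?g b z)" if z: "z \<in> S" for z
  proof -
    have cont: "continuous_on {0..1} (\<lambda>t. F' (y + t *\<^sub>R (z - y)) b)" for b
      by (intro continuous_on_compose2[OF smooth_on_imp_continuous_on[OF smF'[of b]]] continuous_intros)
         (auto simp: in_S[OF z])
    have "((\<lambda>t. F' (y + t *\<^sub>R (z - y)) (z - y)) has_integral
        F (y + 1 *\<^sub>R (z - y)) - F (y + 0 *\<^sub>R (z - y))) {0..1}"
    proof (rule fundamental_theorem_of_calculus)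
      fix t :: real assume t: "t \<in> {0..1}"
      have "((\<lambda>t. y + t *\<^sub>R (z - y)) has_derivative (\<lambda>h. h *\<^sub>R (z - y))) (at t)"
        by (auto intro!: derivative_eq_intros)
      from has_derivative_compose[OF this F'[OF in_S[OF z t]]]
      have "((\<lambda>t. F (y + t *\<^sub>R (z - y))) has_derivative
          (\<lambda>h. F' (y + t *\<^sub>R (z - y)) (h *\<^sub>R (z - y)))) (at t)" .
      then show "((\<lambda>t. F (y + t *\<^sub>R (z - y))) has_vector_derivative
          F' (y + t *\<^sub>R (z - y)) (z - y)) (at t within {0..1})"
        using linear_cmul[OF has_derivative_linear[OF F'[OF in_S[OF z t]]]]
        by (auto simp: has_vector_derivative_def intro!: has_derivative_at_withinI)
    qed simp
    then have "F z - F y = integral {0..1} (\<lambda>t. F' (y + t *\<^sub>R (z - y)) (z - y))"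
      by (simp add: has_integral_iff)
    also have "\<dots> = integral {0..1} (\<lambda>t. \<Sum>b\<in>Basis. ((z - y) \<bullet> b) * F' (y + t *\<^sub>R (z - y)) b)"
    proof (rule integral_cong)
      fix t :: real assume t: "t \<in> {0..1}"
      have lin: "linear (F' (y + t *\<^sub>R (z - y)))"
        using has_derivative_linear[OF F'[OF in_S[OF z t]]] .
      have "F' (y + t *\<^sub>R (z - y)) (z - y) =
          F' (y + t *\<^sub>R (z - y)) (\<Sum>b\<in>Basis. ((z - y) \<bullet> b) *\<^sub>R b)"
        by (simp add: euclidean_representation)
      also have "\<dots> = (\<Sum>b\<in>Basis. ((z - y) \<bullet> b) * F' (y + t *\<^sub>R (z - y)) b)"
        using lin by (simp add: linear_sum linear_cmul)
      finally show "F' (y + t *\<^sub>R (z - y)) (z - y) = \<dots>" .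
    qed
    also have "\<dots> = (\<Sum>b\<in>Basis. ((z - y) \<bullet> b) * ?g b z)"
      by (subst integral_sum)
         (auto intro!: integrable_continuous_real continuous_intros cont)
    finally show ?thesis by simp
  qed
qed

text \<open>A function that is smooth on S only extends to a globally smooth one once it is multiplied by a
  cut-off supported in S; its values outside of S are arbitrary but are multiplied by 0.\<close>

lemma smooth_on_cutoff:
  fixes g :: "'a::euclidean_space \<Rightarrow> real"
  assumes "open S" "smooth_on S g" "smooth_on UNIV \<eta>" "closed K" "K \<subseteq> S" "\<And>z. z \<notin> K \<Longrightarrow> \<eta> z = 0"
  shows "smooth_on UNIV (\<lambda>z. \<eta> z * g z)"
proof (rule smooth_on_local)
  fix z
  show "\<exists>T. open T \<and> z \<in> T \<and> smooth_on T (\<lambda>z. \<eta> z * g z)"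
  proof (cases "z \<in> S")
    case True
    have "smooth_on S (\<lambda>z. \<eta> z * g z)"
      using assms(2) smooth_on_subset[OF assms(3)] by (intro smooth_on_mult assms(1)) auto
    then show ?thesis using True assms(1) by blast
  next
    case False
    have "smooth_on (- K) (\<lambda>z. \<eta> z * g z)"
      by (rule smooth_on_cong[OF _ _ smooth_on_const[of _ 0]]) (use assms in auto)
    moreover have "open (- K)" "z \<in> - K" using assms False by auto
    ultimately show ?thesis by blast
  qed
qed

section \<open>Smooth functions and local frames\<close>

lemma
  assumes M: "smooth_manifold A" and c: "(U, \<phi>) \<in> A"
  shows chart_open: "open U" "open (\<phi> ` U)"
    and chart_continuous: "continuous_on U \<phi>" "continuous_on (\<phi> ` U) (inv_into U \<phi>)"
    and chart_inverse: "q \<in> U \<Longrightarrow> inv_into U \<phi> (\<phi> q) = q"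
proof -
  have "open U \<and> open (\<phi> ` U) \<and> homeomorphism U (\<phi> ` U) \<phi> (inv_into U \<phi>)"
    using M c unfolding smooth_manifold_def by blast
  then show "open U" "open (\<phi> ` U)" "continuous_on U \<phi>" "continuous_on (\<phi> ` U) (inv_into U \<phi>)"
    "q \<in> U \<Longrightarrow> inv_into U \<phi> (\<phi> q) = q"
    by (auto simp: homeomorphism_def)
qed

lemma chart_transition_smooth:
  assumes "smooth_manifold A" "(U, \<phi>) \<in> A" "(V, \<psi>) \<in> A"
  shows "smooth_on (\<phi> ` (U \<inter> V)) (\<psi> \<circ> inv_into U \<phi>)"
  using assms unfolding smooth_manifold_def by blast

lemma smooth_funsD:
  "f \<in> smooth_funs A \<Longrightarrow> (U, \<phi>) \<in> A \<Longrightarrow> smooth_on (\<phi> ` U) (f \<circ> inv_into U \<phi>)"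
  unfolding smooth_funs_def by blast

lemma smooth_funs_const: "(\<lambda>q. c) \<in> smooth_funs A"
  by (auto simp: smooth_funs_def o_def smooth_on_const)

lemma
  assumes "smooth_manifold A" "f \<in> smooth_funs A" "g \<in> smooth_funs A"
  shows smooth_funs_add: "(\<lambda>q. f q + g q) \<in> smooth_funs A"
    and smooth_funs_mult: "(\<lambda>q. f q * g q) \<in> smooth_funs A"
    and smooth_funs_diff: "(\<lambda>q. f q - g q) \<in> smooth_funs A"
  using assms chart_open[OF assms(1)] unfolding smooth_funs_def o_def
  by (auto intro!: smooth_on_add smooth_on_mult smooth_on_diff)

lemma smooth_funs_sum:
  assumes "smooth_manifold A" "\<And>i. i \<in> I \<Longrightarrow> f i \<in> smooth_funs A"
  shows "(\<lambda>q. \<Sum>i\<in>I. f i q) \<in> smooth_funs A"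
  using assms(2)
  by (induction I rule: infinite_finite_induct)
     (auto intro: smooth_funs_const smooth_funs_add assms(1))

definition chart_lift :: "'m set \<Rightarrow> ('m \<Rightarrow> 'e) \<Rightarrow> ('e \<Rightarrow> real) \<Rightarrow> 'm \<Rightarrow> real" where
  "chart_lift U \<phi> u = (\<lambda>q. if q \<in> U then u (\<phi> q) else 0)"

text \<open>The extension by 0 is smooth because the compact support K of u has a compact image in the
  manifold, which is closed by the Hausdorff property; so the manifold is covered by the open set U and
  by an open set where the extension vanishes.\<close>

lemma chart_lift_smooth:
  assumes M: "smooth_manifold A" and c: "(U, \<phi>) \<in> A" and u: "smooth_on (\<phi> ` U) u"
    and K: "compact K" "K \<subseteq> \<phi> ` U" "\<And>z. z \<notin> K \<Longrightarrow> u z = 0"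
  shows "chart_lift U \<phi> u \<in> smooth_funs A"
proof -
  define L where "L = inv_into U \<phi> ` K"
  have "compact L"
    unfolding L_def using chart_continuous(2)[OF M c] K by (auto intro: compact_continuous_image continuous_on_subset)
  then have L: "open (- L)" by (auto dest: compact_imp_closed)
  have "smooth_on (\<psi> ` V) (chart_lift U \<phi> u \<circ> inv_into V \<psi>)" if d: "(V, \<psi>) \<in> A" for V \<psi>
  proof (rule smooth_on_local)
    fix z assume z: "z \<in> \<psi> ` V"
    have pre: "open (\<psi> ` V \<inter> inv_into V \<psi> -` W)" if "open W" for W
      by (rule continuous_open_preimage[OF chart_continuous(2) chart_open(2)]) (use M d that in auto)
    show "\<exists>T. open T \<and> z \<in> T \<and> smooth_on T (chart_lift U \<phi> u \<circ> inv_into V \<psi>)"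
    proof (cases "inv_into V \<psi> z \<in> U")
      case True
      define T where "T = \<psi> ` V \<inter> inv_into V \<psi> -` U"
      have T: "open T" "z \<in> T" using pre[OF chart_open(1)[OF M c]] True z by (auto simp: T_def)
      have "T \<subseteq> \<psi> ` (V \<inter> U)"
        by (auto simp: T_def chart_inverse[OF M d])
      then have s: "smooth_on T (\<phi> \<circ> inv_into V \<psi>)"
        using chart_transition_smooth[OF M d c] smooth_on_subset by blast
      have "smooth_on T (\<lambda>w. u ((\<phi> \<circ> inv_into V \<psi>) w))"
        by (rule smooth_on_compose[OF T(1) chart_open(2)[OF M c] _ s u]) (auto simp: T_def)
      then have "smooth_on T (chart_lift U \<phi> u \<circ> inv_into V \<psi>)"
        by (rule smooth_on_cong[OF T(1), rotated]) (auto simp: T_def chart_lift_def)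
      then show ?thesis using T by blast
    next
      case False
      define T where "T = \<psi> ` V \<inter> inv_into V \<psi> -` (- L)"
      have "inv_into V \<psi> z \<notin> L"
        using False K(2) unfolding L_def by (metis imageE inv_into_into subsetD)
      then have T: "open T" "z \<in> T" using pre[OF L] z by (auto simp: T_def)
      have "chart_lift U \<phi> u (inv_into V \<psi> w) = 0" if "w \<in> T" for w
      proof (cases "inv_into V \<psi> w \<in> U")
        case True
        have "\<phi> (inv_into V \<psi> w) \<notin> K"
          using that chart_inverse[OF M c True] unfolding T_def L_def by (force simp: image_iff)
        then show ?thesis using K(3) by (auto simp: chart_lift_def)
      qed (simp add: chart_lift_def)
      then have "smooth_on T (chart_lift U \<phi> u \<circ> inv_into V \<psi>)"
        by (intro smooth_on_cong[OF T(1) _ smooth_on_const[of _ 0]]) auto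
      then show ?thesis using T by blast
    qed
  qed
  then show ?thesis by (auto simp: smooth_funs_def)
qed

lemma
  assumes "v \<in> tangent_space A p" "f \<in> smooth_funs A"
  shows tangent_add: "g \<in> smooth_funs A \<Longrightarrow> v (\<lambda>q. f q + g q) = v f + v g"
    and tangent_scale: "v (\<lambda>q. c * f q) = c * v f"
    and tangent_mult: "g \<in> smooth_funs A \<Longrightarrow> v (\<lambda>q. f q * g q) = v f * g p + f p * v g"
  using assms unfolding tangent_space_def linear_functional_on_def by blast+

lemma tangent_const:
  assumes v: "v \<in> tangent_space A p"
  shows "v (\<lambda>q. c) = 0"
  using tangent_mult[OF v smooth_funs_const[of 1] smooth_funs_const[of 1]]
    tangent_scale[OF v smooth_funs_const[of 1], of c] by simp

lemma tangent_sum: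
  assumes "smooth_manifold A" and v: "v \<in> tangent_space A p" and "\<And>i. i \<in> I \<Longrightarrow> f i \<in> smooth_funs A"
  shows "v (\<lambda>q. \<Sum>i\<in>I. f i q) = (\<Sum>i\<in>I. v (f i))"
  using assms(3)
  by (induction I rule: infinite_finite_induct)
     (auto simp: tangent_const[OF v] tangent_add[OF v] smooth_funs_sum[OF assms(1)])

lemma tangent_extensional: "v \<in> tangent_space A p \<Longrightarrow> f \<notin> smooth_funs A \<Longrightarrow> v f = 0"
  unfolding tangent_space_def by blast

text \<open>All linear algebra of tangent spaces and all localization of vector fields below rest on this
  notion.  In the motivating example x is a cut-off coordinate system near p, E is its frame of partial
  derivatives multiplied by a bump function \<open>\<kappa>\<close>, and both sides of the identity
  $\<kappa> v = \<Sum>_b v(x_b) E_b$ vanish off the coordinate domain.  Because x, E and \<open>\<kappa>\<close> are globally defined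
  and the identity holds at all points, it can be applied to global vector fields.\<close>

definition frame_around ::
  "('m::{t2_space,second_countable_topology}, 'e::euclidean_space) chart set \<Rightarrow> 'm \<Rightarrow>
   ('e \<Rightarrow> 'm \<Rightarrow> real) \<Rightarrow> ('e \<Rightarrow> 'm vfield) \<Rightarrow> ('m \<Rightarrow> real) \<Rightarrow> bool" where
  "frame_around A p x E \<kappa> \<longleftrightarrow>
     (\<forall>b\<in>Basis. x b \<in> smooth_funs A \<and> E b \<in> vector_fields A) \<and>
     (\<forall>b\<in>Basis. \<forall>c\<in>Basis. E b p (x c) = (if b = c then 1 else 0)) \<and>
     \<kappa> \<in> smooth_funs A \<and> \<kappa> p = 1 \<and>
     (\<forall>q. \<forall>v\<in>tangent_space A q. \<forall>f. \<kappa> q * v f = (\<Sum>b\<in>Basis. v (x b) * E b q f))"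

text \<open>In a chart around p the frame consists of the coordinates and partial derivatives, cut off and
  extended by 0.  The expansion of a derivation v at q is the classical argument: by Hadamard's lemma f is
  f(q) plus a sum of products of the coordinates minus their values at q with smooth functions, and v
  sees only the values at q of the latter.  Since tangent vectors act on globally defined functions,
  everything is multiplied by cut-offs first.\<close>

lemma frame_exists:
  fixes A :: "('m::{t2_space,second_countable_topology}, 'e::euclidean_space) chart set"
  assumes M: "smooth_manifold A"
  obtains x E \<kappa> where "frame_around A p x E \<kappa>"
proof -
  obtain U \<phi> where c: "(U, \<phi>) \<in> A" and p: "p \<in> U"
    using M unfolding smooth_manifold_def by blast
  note [simp] = chart_inverse[OF M c]
  define x0 where "x0 = \<phi> p"
  obtain R where R: "R > 0" "cball x0 R \<subseteq> \<phi> ` U"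
    using chart_open(2)[OF M c] p unfolding x0_def open_contains_cball by blast
  \<comment> \<open>Three nested cut-offs: \<open>\<theta>\<close> cuts off the frame, \<open>\<eta>\<close> is 1 wherever \<open>\<theta>\<close> does not vanish and
    localizes Hadamard's identity, and \<open>\<rho>\<close> is 1 wherever \<open>\<eta>\<close> does not vanish and cuts off the coordinates.\<close>
  obtain \<theta> where \<theta>: "smooth_on UNIV \<theta>" "\<And>z. z \<in> cball x0 (R/4) \<Longrightarrow> \<theta> z = 1"
    "\<And>z. z \<notin> ball x0 (R/2) \<Longrightarrow> \<theta> z = (0::real)"
    using bump_function[of "R/4" "R/2" x0] R(1) by auto
  obtain \<eta> where \<eta>: "smooth_on UNIV \<eta>" "\<And>z. z \<in> cball x0 (R/2) \<Longrightarrow> \<eta> z = 1"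
    "\<And>z. z \<notin> ball x0 (3*R/4) \<Longrightarrow> \<eta> z = (0::real)"
    using bump_function[of "R/2" "3*R/4" x0] R(1) by auto
  obtain \<rho> where \<rho>: "smooth_on UNIV \<rho>" "\<And>z. z \<in> cball x0 (3*R/4) \<Longrightarrow> \<rho> z = 1"
    "\<And>z. z \<notin> ball x0 R \<Longrightarrow> \<rho> z = (0::real)"
    using bump_function[of "3*R/4" R x0] R(1) by auto
  let ?l = "chart_lift U \<phi>" and ?i = "inv_into U \<phi>"
  define d where "d = (\<lambda>b (f :: 'm \<Rightarrow> real) z. frechet_derivative (f \<circ> ?i) (at z) b)"
  define x where "x = (\<lambda>b. ?l (\<lambda>z. \<rho> z * (z \<bullet> b)))"
  define E where "E = (\<lambda>b q f. if f \<in> smooth_funs A then ?l (\<lambda>z. \<theta> z * d b f z) q else 0)"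
  have lift: "?l u \<in> smooth_funs A" if "smooth_on UNIV u" "\<And>z. z \<notin> cball x0 R \<Longrightarrow> u z = 0" for u
    by (rule chart_lift_smooth[OF M c smooth_on_subset[OF that(1)] compact_cball R(2) that(2)]) auto
  have lin: "smooth_on UNIV (\<lambda>z::'e. z \<bullet> b)" for b
    by (simp add: smooth_on_linear bounded_linear_inner_left)
  have x: "x b \<in> smooth_funs A" for b
    unfolding x_def by (intro lift smooth_on_mult \<rho>(1) lin) (auto simp: \<rho>(3))
  have \<kappa>: "?l \<theta> \<in> smooth_funs A"
    by (intro lift \<theta>(1)) (use R(1) in \<open>auto simp: \<theta>(3)\<close>)
  have der: "((f \<circ> ?i) has_derivative (\<lambda>b. d b f z)) (at z)" if "f \<in> smooth_funs A" "z \<in> \<phi> ` U" for f z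
    unfolding d_def by (rule smooth_on_has_derivative[OF smooth_funsD[OF that(1) c] that(2)])
  have dI: "d b f z = D b" if "((f \<circ> ?i) has_derivative D) (at z)" for b f z D
    unfolding d_def by (simp add: frechet_derivative_eqI[OF that])
  have E: "E b \<in> vector_fields A" for b
    unfolding vector_fields_def
  proof (safe)
    fix q
    show "E b q \<in> tangent_space A q"
    proof (cases "q \<in> U")
      case False
      then show ?thesis
        by (auto simp: tangent_space_def E_def chart_lift_def linear_functional_on_def)
    next
      case True
      have "d b (\<lambda>a. f a + g a) (\<phi> q) = d b f (\<phi> q) + d b g (\<phi> q)"
        if "f \<in> smooth_funs A" "g \<in> smooth_funs A" for f g
        by (rule dI) (use has_derivative_add[OF der der] that True in \<open>auto simp: o_def\<close>)
      moreover have "d b (\<lambda>a. k * f a) (\<phi> q) = k * d b f (\<phi> q)" if "f \<in> smooth_funs A" for f k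
        by (rule dI) (use has_derivative_mult_right[OF der] that True in \<open>auto simp: o_def\<close>)
      moreover have "d b (\<lambda>a. f a * g a) (\<phi> q) = f q * d b g (\<phi> q) + d b f (\<phi> q) * g q"
        if "f \<in> smooth_funs A" "g \<in> smooth_funs A" for f g
      proof (rule dI)
        have "\<phi> q \<in> \<phi> ` U" using True by simp
        from has_derivative_mult[OF der[OF that(1) this] der[OF that(2) this]]
        show "(((\<lambda>a. f a * g a) \<circ> ?i) has_derivative
            (\<lambda>b. f q * d b g (\<phi> q) + d b f (\<phi> q) * g q)) (at (\<phi> q))"
          using True by (simp add: o_def)
      qed
      ultimately show ?thesis using True
        by (auto simp: tangent_space_def E_def chart_lift_def linear_functional_on_def algebra_simps
            smooth_funs_add[OF M] smooth_funs_mult[OF M] smooth_funs_mult[OF M smooth_funs_const])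
    qed
  next
    fix f assume f: "f \<in> smooth_funs A"
    have "?l (\<lambda>z. \<theta> z * d b f z) \<in> smooth_funs A"
    proof (rule lift)
      show "smooth_on UNIV (\<lambda>z. \<theta> z * d b f z)"
        unfolding d_def
        by (rule smooth_on_cutoff[OF chart_open(2)[OF M c] smooth_on_derivative[OF smooth_funsD[OF f c]]
            \<theta>(1) _ R(2)]) (use R(1) in \<open>auto simp: \<theta>(3)\<close>)
    qed (use R(1) in \<open>auto simp: \<theta>(3)\<close>)
    then show "(\<lambda>q. E b q f) \<in> smooth_funs A" using f by (simp add: E_def)
  qed
  have expand: "?l \<theta> q * v f = (\<Sum>b\<in>Basis. v (x b) * E b q f)" if v: "v \<in> tangent_space A q" for q v f
  proof (cases "f \<in> smooth_funs A \<and> q \<in> U \<and> \<phi> q \<in> ball x0 (R/2)")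
    case False
    then have "E b q f = 0" for b using \<theta>(3) by (auto simp: E_def chart_lift_def)
    moreover have "?l \<theta> q * v f = 0"
      using False tangent_extensional[OF v] \<theta>(3) by (auto simp: chart_lift_def)
    ultimately show ?thesis by simp
  next
    case True
    define y where "y = \<phi> q"
    from True have f: "f \<in> smooth_funs A" and q: "q \<in> U" and y: "y \<in> ball x0 (R/2)" by (auto simp: y_def)
    have yS: "y \<in> ball x0 R" using y R(1) by auto
    have \<eta>y: "\<eta> y = 1" using \<eta>(2) y by simp
    have "dist x0 y \<le> 3 * R / 4" using y R(1) unfolding mem_ball by linarith
    then have \<rho>y: "\<rho> y = 1" using \<rho>(2) by simp
    have "ball x0 R \<subseteq> \<phi> ` U" using R(2) by force
    then have F: "smooth_on (ball x0 R) (f \<circ> ?i)"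
      by (rule smooth_on_subset[OF smooth_funsD[OF f c]])
    obtain g where g: "\<And>b. smooth_on (ball x0 R) (g b)"
      "\<And>b. g b y = frechet_derivative (f \<circ> ?i) (at y) b"
      "\<And>z. z \<in> ball x0 R \<Longrightarrow> (f \<circ> ?i) z = (f \<circ> ?i) y + (\<Sum>b\<in>Basis. ((z - y) \<bullet> b) * g b z)"
      using hadamard_lemma[OF open_ball convex_ball yS F] by blast
    have gy: "g b y = d b f y" for b by (simp add: d_def g(2))
    define H where "H = ?l \<eta>"
    define X where "X = (\<lambda>b. ?l (\<lambda>z. \<eta> z * ((z - y) \<bullet> b)))"
    define k where "k = (\<lambda>b. ?l (\<lambda>z. \<eta> z * g b z))"
    have H: "H \<in> smooth_funs A"
      unfolding H_def by (intro lift \<eta>(1)) (use R(1) in \<open>auto simp: \<eta>(3)\<close>)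
    have "smooth_on UNIV (\<lambda>z. (z - y) \<bullet> b)" for b
      unfolding inner_diff_left by (intro smooth_on_diff lin smooth_on_const) simp
    then have X: "X b \<in> smooth_funs A" for b
      unfolding X_def by (intro lift smooth_on_mult \<eta>(1)) (use R(1) in \<open>auto simp: \<eta>(3)\<close>)
    have k: "k b \<in> smooth_funs A" for b
      unfolding k_def
      by (intro lift smooth_on_cutoff[OF open_ball g(1) \<eta>(1), of "cball x0 (3*R/4)"])
         (use R(1) in \<open>auto simp: \<eta>(3)\<close>)
    have at_q: "H q = 1" "X b q = 0" "k b q = d b f y" "x b q = y \<bullet> b" for b
      using q \<eta>y \<rho>y by (auto simp: H_def X_def k_def x_def chart_lift_def gy y_def[symmetric])
    \<comment> \<open>The functions X b and x b differ near q only by a constant, but v is not known to be local: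
      that follows from the product rule, with H as the second factor.\<close>
    have vX: "v (X b) = v (x b)" for b
    proof -
      have "X b = (\<lambda>a. H a * (x b a - y \<bullet> b))"
      proof
        fix a
        have "\<eta> (\<phi> a) = 0 \<or> \<rho> (\<phi> a) = 1" using \<eta>(3) \<rho>(2) by force
        then show "X b a = H a * (x b a - y \<bullet> b)"
          by (auto simp: X_def H_def x_def chart_lift_def inner_diff_left)
      qed
      then have "v (X b) = v (\<lambda>a. x b a - y \<bullet> b)"
        using tangent_mult[OF v H smooth_funs_diff[OF M x smooth_funs_const]] by (simp add: at_q)
      also have "\<dots> = v (x b)"
        using tangent_add[OF v x smooth_funs_const, of b "- (y \<bullet> b)"] tangent_const[OF v] by simp
      finally show ?thesis .
    qed
    \<comment> \<open>Hadamard's identity, multiplied by the square of the cut-off: one factor goes to the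
      coordinates and one to the coefficients, so that each of them becomes globally smooth.\<close>
    have "(\<lambda>a. H a * (H a * f a)) = (\<lambda>a. f q * (H a * H a) + (\<Sum>b\<in>Basis. X b a * k b a))"
    proof
      fix a
      show "H a * (H a * f a) = f q * (H a * H a) + (\<Sum>b\<in>Basis. X b a * k b a)"
      proof (cases "a \<in> U \<and> \<phi> a \<in> ball x0 (3*R/4)")
        case False
        then show ?thesis using \<eta>(3) by (auto simp: H_def X_def chart_lift_def)
      next
        case True
        then have "\<phi> a \<in> ball x0 R" using R(1) by auto
        from g(3)[OF this] have fa: "f a = f q + (\<Sum>b\<in>Basis. ((\<phi> a - y) \<bullet> b) * g b (\<phi> a))"
          using True q by (simp add: y_def)
        show ?thesis unfolding fa using True
          by (simp add: H_def X_def k_def chart_lift_def algebra_simps sum_distrib_left)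
      qed
    qed
    then have "v (\<lambda>a. H a * (H a * f a)) = v (\<lambda>a. f q * (H a * H a) + (\<Sum>b\<in>Basis. X b a * k b a))"
      by simp
    moreover have "v (\<lambda>a. H a * (H a * f a)) = 2 * v H * f q + v f"
      by (simp add: tangent_mult[OF v] smooth_funs_mult[OF M] H f at_q)
    moreover have "v (\<lambda>a. f q * (H a * H a) + (\<Sum>b\<in>Basis. X b a * k b a)) =
        f q * (2 * v H) + (\<Sum>b\<in>Basis. v (x b) * d b f y)"
      by (simp add: tangent_mult[OF v] smooth_funs_mult[OF M] H X k at_q vX tangent_add[OF v]
          tangent_scale[OF v] tangent_sum[OF M v] smooth_funs_sum[OF M] smooth_funs_const
          tangent_const[OF v])
    ultimately have "v f = (\<Sum>b\<in>Basis. v (x b) * d b f y)" by simp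
    then show ?thesis using f q
      by (simp add: E_def chart_lift_def y_def sum_distrib_left mult_ac)
  qed
  have delta: "E b p (x c') = (if b = c' then 1 else 0)" if "b \<in> Basis" "c' \<in> Basis" for b c'
  proof -
    have "((x c' \<circ> ?i) has_derivative (\<lambda>z. z \<bullet> c')) (at x0)"
    proof (rule has_derivative_transform_within_open[of "\<lambda>z. z \<bullet> c'" _ _ _ "ball x0 (3*R/4)"])
      show "((\<lambda>z. z \<bullet> c') has_derivative (\<lambda>z. z \<bullet> c')) (at x0)"
        by (auto intro!: derivative_eq_intros)
      fix z assume z: "z \<in> ball x0 (3*R/4)"
      then have "z \<in> \<phi> ` U" using R by (intro subsetD[OF R(2)]) auto
      then show "z \<bullet> c' = (x c' \<circ> ?i) z"
        using z \<rho>(2)[of z] by (auto simp: x_def chart_lift_def)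
    qed (use R(1) in auto)
    then have "d b (x c') x0 = b \<bullet> c'" by (rule dI)
    then show ?thesis using p x that \<theta>(2)[of x0] R(1)
      by (simp add: E_def chart_lift_def x0_def inner_Basis)
  qed
  have "?l \<theta> p = 1" using p \<theta>(2)[of x0] R(1) by (simp add: chart_lift_def x0_def)
  then have "frame_around A p x E (?l \<theta>)"
    by (simp add: frame_around_def x E \<kappa> expand delta)
  then show ?thesis by (rule that)
qed

section \<open>Tangent vectors, covectors and their extensions\<close>

definition function_space :: "('a \<Rightarrow> real) set \<Rightarrow> bool" where
  "function_space V \<longleftrightarrow> (\<lambda>a. 0) \<in> V \<and> (\<forall>x\<in>V. \<forall>y\<in>V. (\<lambda>a. x a + y a) \<in> V) \<and>
     (\<forall>c. \<forall>x\<in>V. (\<lambda>a. c * x a) \<in> V)"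

lemma
  assumes "linear_functional_on V L" "x \<in> V"
  shows linear_functional_on_add: "y \<in> V \<Longrightarrow> L (\<lambda>a. x a + y a) = L x + L y"
    and linear_functional_on_scale: "L (\<lambda>a. c * x a) = c * L x"
  using assms unfolding linear_functional_on_def by blast+

lemma
  assumes "function_space V" "x \<in> V"
  shows function_space_add: "y \<in> V \<Longrightarrow> (\<lambda>a. x a + y a) \<in> V"
    and function_space_scale: "(\<lambda>a. c * x a) \<in> V"
  using assms by (simp_all add: function_space_def)

lemma function_space_sum:
  assumes V: "function_space V" and x: "\<And>i. i \<in> I \<Longrightarrow> x i \<in> V"
  shows "(\<lambda>a. \<Sum>i\<in>I. c i * x i a) \<in> V"
  using x V
  by (induction I rule: infinite_finite_induct) (simp_all add: function_space_def)

lemma linear_functional_on_sum: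
  assumes V: "function_space V" and L: "linear_functional_on V L" and x: "\<And>i. i \<in> I \<Longrightarrow> x i \<in> V"
  shows "L (\<lambda>a. \<Sum>i\<in>I. c i * x i a) = (\<Sum>i\<in>I. c i * L (x i))"
proof -
  have zero: "L (\<lambda>a. 0) = 0"
    using linear_functional_on_scale[OF L, of "\<lambda>a. 0" 0] V by (simp add: function_space_def)
  show ?thesis
    using x
  proof (induction I rule: infinite_finite_induct)
    case (insert i I)
    have "(\<lambda>a. c i * x i a) \<in> V" using V insert.prems by (simp add: function_space_def)
    then have "L (\<lambda>a. c i * x i a + (\<Sum>i\<in>I. c i * x i a)) = c i * L (x i) + L (\<lambda>a. \<Sum>i\<in>I. c i * x i a)"
      using linear_functional_on_add[OF L _ function_space_sum[OF V, of I x c]]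
        linear_functional_on_scale[OF L, of "x i" "c i"] insert.prems
      by auto
    then show ?case using insert by simp
  qed (simp_all add: zero)
qed

lemma function_space_tangent: "smooth_manifold A \<Longrightarrow> function_space (tangent_space A p)"
  unfolding function_space_def tangent_space_def linear_functional_on_def
  by (auto simp: algebra_simps)

lemma function_space_cotangent: "function_space (cotangent_space A p)"
  unfolding function_space_def cotangent_space_def linear_functional_on_def
  by (auto simp: algebra_simps)

lemma zero_cotangent: "(\<lambda>v. 0) \<in> cotangent_space A p"
  using function_space_cotangent unfolding function_space_def by blast

lemma
  assumes "\<xi> \<in> cotangent_space A p"
  shows cotangent_linear: "linear_functional_on (tangent_space A p) \<xi>"
    and cotangent_extensional: "v \<notin> tangent_space A p \<Longrightarrow> \<xi> v = 0"
  using assms unfolding cotangent_space_def by auto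

lemma
  assumes "X \<in> vector_fields A"
  shows vector_fields_tangent: "X p \<in> tangent_space A p"
    and vector_fields_smooth: "f \<in> smooth_funs A \<Longrightarrow> (\<lambda>p. X p f) \<in> smooth_funs A"
  using assms unfolding vector_fields_def by auto

lemma
  assumes "\<alpha> \<in> one_forms A"
  shows one_forms_cotangent: "\<alpha> p \<in> cotangent_space A p"
    and one_forms_smooth: "X \<in> vector_fields A \<Longrightarrow> (\<lambda>p. \<alpha> p (X p)) \<in> smooth_funs A"
  using assms unfolding one_forms_def by auto

lemma
  assumes M: "smooth_manifold A" and X: "X \<in> vector_fields A"
  shows vector_fields_add: "Y \<in> vector_fields A \<Longrightarrow> (\<lambda>p f. X p f + Y p f) \<in> vector_fields A"
    and vector_fields_mult: "h \<in> smooth_funs A \<Longrightarrow> (\<lambda>p f. h p * X p f) \<in> vector_fields A"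
  using X function_space_tangent[OF M] unfolding vector_fields_def function_space_def
  by (auto intro!: smooth_funs_add[OF M] smooth_funs_mult[OF M])

lemma vector_fields_zero: "smooth_manifold A \<Longrightarrow> (\<lambda>p f. 0) \<in> vector_fields A"
  using function_space_tangent unfolding vector_fields_def function_space_def
  by (auto intro!: smooth_funs_const)

lemma vector_fields_sum:
  assumes M: "smooth_manifold A" and "\<And>i. i \<in> I \<Longrightarrow> h i \<in> smooth_funs A"
    "\<And>i. i \<in> I \<Longrightarrow> X i \<in> vector_fields A"
  shows "(\<lambda>p f. \<Sum>i\<in>I. h i p * X i p f) \<in> vector_fields A"
  using assms(2,3)
  by (induction I rule: infinite_finite_induct)
     (auto simp: vector_fields_zero[OF M] intro!: vector_fields_add[OF M] vector_fields_mult[OF M])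

lemma one_forms_diff:
  assumes M: "smooth_manifold A" and \<alpha>: "\<alpha> \<in> one_forms A"
    and \<beta>: "\<beta> \<in> one_forms A"
  shows "(\<lambda>p v. \<alpha> p v - \<beta> p v) \<in> one_forms A"
  using \<alpha> \<beta> unfolding one_forms_def cotangent_space_def linear_functional_on_def
  by (auto intro!: smooth_funs_diff[OF M] simp: algebra_simps)

lemma differential_one_form:
  assumes M: "smooth_manifold A" and f: "f \<in> smooth_funs A"
  shows "differential A f \<in> one_forms A"
  using f function_space_tangent[OF M] vector_fields_tangent[of _ A] vector_fields_smooth[of _ A f]
  unfolding one_forms_def cotangent_space_def linear_functional_on_def differential_def function_space_def
  by auto

lemma
  assumes "frame_around A p x E \<kappa>"
  shows frame_function: "b \<in> Basis \<Longrightarrow> x b \<in> smooth_funs A"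
    and frame_field: "b \<in> Basis \<Longrightarrow> E b \<in> vector_fields A"
    and frame_tangent: "b \<in> Basis \<Longrightarrow> E b p \<in> tangent_space A p"
    and frame_dual: "b \<in> Basis \<Longrightarrow> c \<in> Basis \<Longrightarrow> E b p (x c) = (if b = c then 1 else 0)"
    and frame_cutoff: "\<kappa> \<in> smooth_funs A" "\<kappa> p = 1"
    and frame_cutoff_expand:
      "v \<in> tangent_space A q \<Longrightarrow> (\<Sum>b\<in>Basis. v (x b) * E b q f) = \<kappa> q * v f"
  using assms by (simp_all add: frame_around_def vector_fields_tangent)

lemma frame_expand:
  assumes "frame_around A p x E \<kappa>" "v \<in> tangent_space A p"
  shows "(\<lambda>f. \<Sum>b\<in>Basis. v (x b) * E b p f) = v"
  by (simp add: frame_cutoff_expand[OF assms] frame_cutoff(2)[OF assms(1)])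

text \<open>The linear combination of the frame fields with constant coefficients.\<close>

lemma tangent_vector_extends:
  fixes A :: "('m::{t2_space,second_countable_topology}, 'e::euclidean_space) chart set"
  assumes M: "smooth_manifold A" and v: "v \<in> tangent_space A p"
  obtains Y where "Y \<in> vector_fields A" "Y p = v"
proof -
  obtain x E \<kappa> where fr: "frame_around A p x E \<kappa>" by (rule frame_exists[OF M])
  show ?thesis
  proof
    show "(\<lambda>q f. \<Sum>b\<in>Basis. v (x b) * E b q f) \<in> vector_fields A"
      by (intro vector_fields_sum[OF M] smooth_funs_const frame_field[OF fr])
    show "(\<lambda>f. \<Sum>b\<in>Basis. v (x b) * E b p f) = v"
      using frame_expand[OF fr v] by simp
  qed
qed

text \<open>The linear combination of the frame coordinates with coefficients \<open>\<xi> (E b p)\<close>.  Consequently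
  identities of tensors can be checked on global one-forms.\<close>

lemma covector_is_differential:
  fixes A :: "('m::{t2_space,second_countable_topology}, 'e::euclidean_space) chart set"
  assumes M: "smooth_manifold A" and \<xi>: "\<xi> \<in> cotangent_space A p"
  obtains f where "f \<in> smooth_funs A" "differential A f p = \<xi>"
proof -
  obtain x E \<kappa> where fr: "frame_around A p x E \<kappa>" by (rule frame_exists[OF M])
  show ?thesis
  proof
    show f: "(\<lambda>q. \<Sum>b\<in>Basis. \<xi> (E b p) * x b q) \<in> smooth_funs A"
      by (intro smooth_funs_sum[OF M] smooth_funs_mult[OF M] smooth_funs_const frame_function[OF fr])
    show "differential A (\<lambda>q. \<Sum>b\<in>Basis. \<xi> (E b p) * x b q) p = \<xi>"
    proof
      fix v
      show "differential A (\<lambda>q. \<Sum>b\<in>Basis. \<xi> (E b p) * x b q) p v = \<xi> v"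
      proof (cases "v \<in> tangent_space A p")
        case True
        have "\<xi> v = \<xi> (\<lambda>f. \<Sum>b\<in>Basis. v (x b) * E b p f)"
          using frame_expand[OF fr True] by simp
        also have "\<dots> = (\<Sum>b\<in>Basis. v (x b) * \<xi> (E b p))"
          by (rule linear_functional_on_sum[OF function_space_tangent[OF M] cotangent_linear[OF \<xi>]])
             (rule frame_tangent[OF fr])
        also have "\<dots> = (\<Sum>b\<in>Basis. \<xi> (E b p) * v (x b))" by (simp add: mult.commute)
        also have "\<dots> = v (\<lambda>q. \<Sum>b\<in>Basis. \<xi> (E b p) * x b q)"
          using frame_function[OF fr] by (simp add: tangent_sum[OF M True] tangent_scale[OF True]
              smooth_funs_mult[OF M smooth_funs_const])
        finally show ?thesis using True by (simp add: differential_def)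
      qed (simp add: differential_def cotangent_extensional[OF \<xi>])
    qed
  qed
qed

lemma covector_extends:
  assumes M: "smooth_manifold A" and \<xi>: "\<xi> \<in> cotangent_space A p"
  obtains \<alpha> where "\<alpha> \<in> one_forms A" "\<alpha> p = \<xi>"
  using covector_is_differential[OF M \<xi>] differential_one_form[OF M] by metis

lemma tangent_eqI:
  assumes M: "smooth_manifold A" and v: "v \<in> tangent_space A p" and w: "w \<in> tangent_space A p"
    and eq: "\<And>\<xi>. \<xi> \<in> cotangent_space A p \<Longrightarrow> \<xi> v = \<xi> w"
  shows "v = w"
proof
  fix f
  show "v f = w f"
  proof (cases "f \<in> smooth_funs A")
    case True
    from eq[OF one_forms_cotangent[OF differential_one_form[OF M True]]] show ?thesis
      using v w by (simp add: differential_def)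
  qed (use v w tangent_extensional in metis)
qed

text \<open>Finite-dimensionality in the form in which the anchor uses it: the differentials of the frame
  coordinates span the covectors, so L is evaluation at the tangent vector with components
  \<open>L (dx b)\<close>.\<close>

lemma tangent_reflexive:
  fixes A :: "('m::{t2_space,second_countable_topology}, 'e::euclidean_space) chart set"
  assumes M: "smooth_manifold A" and L: "linear_functional_on (cotangent_space A p) L"
  shows "\<exists>!v. v \<in> tangent_space A p \<and> (\<forall>\<xi>\<in>cotangent_space A p. \<xi> v = L \<xi>)"
proof -
  obtain x E \<kappa> where fr: "frame_around A p x E \<kappa>" by (rule frame_exists[OF M])
  let ?dx = "\<lambda>b. differential A (x b) p"
  note Ep = frame_tangent[OF fr]
  have dx: "?dx b \<in> cotangent_space A p" if "b \<in> Basis" for b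
    using one_forms_cotangent[OF differential_one_form[OF M frame_function[OF fr that]]] .
  let ?v = "\<lambda>f. \<Sum>b\<in>Basis. L (?dx b) * E b p f"
  have v: "?v \<in> tangent_space A p"
    by (intro function_space_sum[OF function_space_tangent[OF M]] Ep)
  have "\<xi> ?v = L \<xi>" if \<xi>: "\<xi> \<in> cotangent_space A p" for \<xi>
  proof -
    have "\<xi> = (\<lambda>v. \<Sum>b\<in>Basis. \<xi> (E b p) * ?dx b v)"
    proof
      fix v
      show "\<xi> v = (\<Sum>b\<in>Basis. \<xi> (E b p) * ?dx b v)"
      proof (cases "v \<in> tangent_space A p")
        case True
        have "\<xi> v = \<xi> (\<lambda>f. \<Sum>b\<in>Basis. v (x b) * E b p f)"
          using frame_expand[OF fr True] by simp
        also have "\<dots> = (\<Sum>b\<in>Basis. v (x b) * \<xi> (E b p))"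
          by (rule linear_functional_on_sum[OF function_space_tangent[OF M] cotangent_linear[OF \<xi>] Ep])
        finally show ?thesis using True by (simp add: differential_def mult.commute)
      qed (simp add: differential_def cotangent_extensional[OF \<xi>])
    qed
    then have "L \<xi> = L (\<lambda>v. \<Sum>b\<in>Basis. \<xi> (E b p) * ?dx b v)" by simp
    also have "\<dots> = (\<Sum>b\<in>Basis. \<xi> (E b p) * L (?dx b))"
      by (rule linear_functional_on_sum[OF function_space_cotangent L dx])
    also have "\<dots> = \<xi> ?v"
      using linear_functional_on_sum[OF function_space_tangent[OF M] cotangent_linear[OF \<xi>] Ep,
          of Basis "\<lambda>b. b" "\<lambda>b. L (?dx b)"]
      by (simp add: mult.commute)
    finally show ?thesis by simp
  qed
  note v' = this
  show ?thesis
  proof (rule ex1I)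
    show "?v \<in> tangent_space A p \<and> (\<forall>\<xi>\<in>cotangent_space A p. \<xi> ?v = L \<xi>)"
      using v v' by blast
    fix w assume w: "w \<in> tangent_space A p \<and> (\<forall>\<xi>\<in>cotangent_space A p. \<xi> w = L \<xi>)"
    show "w = ?v"
    proof (rule tangent_eqI[OF M _ v])
      show "\<xi> w = \<xi> ?v" if "\<xi> \<in> cotangent_space A p" for \<xi>
        using w v'[OF that] that by metis
    qed (use w in blast)
  qed
qed

lemma
  assumes "bilinear_form_on V B" "x \<in> V"
  shows bilinear_form_on_right: "linear_functional_on V (B x)"
    and bilinear_form_on_left: "linear_functional_on V (\<lambda>y. B y x)"
  using assms unfolding bilinear_form_on_def by auto

section \<open>The dual metric\<close>

lemma
  assumes "pseudo_riemannian_metric A G"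
  shows metric_bilinear: "bilinear_form_on (tangent_space A p) (G p)"
    and metric_sym: "v \<in> tangent_space A p \<Longrightarrow> w \<in> tangent_space A p \<Longrightarrow> G p v w = G p w v"
    and metric_nondegenerate: "v \<in> tangent_space A p \<Longrightarrow> (\<And>w. w \<in> tangent_space A p \<Longrightarrow> G p v w = 0) \<Longrightarrow>
      v = (\<lambda>f. 0)"
  using assms unfolding pseudo_riemannian_metric_def by blast+

text \<open>Nondegeneracy says that lowering an index is injective.  In the frame it becomes a linear
  endomorphism \<open>\<Phi>\<close> of the model space, so injectivity implies surjectivity.  The frame is independent at p
  by its duality with the coordinates, which is what makes \<open>\<Phi>\<close> injective.\<close>

lemma metric_surjective:
  fixes A :: "('m::{t2_space,second_countable_topology}, 'e::euclidean_space) chart set"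
  assumes M: "smooth_manifold A" and G: "pseudo_riemannian_metric A G"
    and \<xi>: "\<xi> \<in> cotangent_space A p"
  shows "\<exists>v\<in>tangent_space A p. \<forall>w\<in>tangent_space A p. G p v w = \<xi> w"
proof -
  obtain x E \<kappa> where fr: "frame_around A p x E \<kappa>" by (rule frame_exists[OF M])
  note Ep = frame_tangent[OF fr]
  note T = function_space_tangent[OF M, of p]
  have determined: "L w = L' w"
    if L: "linear_functional_on (tangent_space A p) L" and L': "linear_functional_on (tangent_space A p) L'"
      and eq: "\<And>c. c \<in> Basis \<Longrightarrow> L (E c p) = L' (E c p)" and w: "w \<in> tangent_space A p" for L L' w
  proof -
    have "K w = (\<Sum>c\<in>Basis. w (x c) * K (E c p))" if "linear_functional_on (tangent_space A p) K" for K
      using linear_functional_on_sum[OF T that Ep, of Basis "\<lambda>b. b" "\<lambda>c. w (x c)"] frame_expand[OF fr w]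
      by simp
    from this[OF L] this[OF L'] show ?thesis using eq by simp
  qed
  define V where "V = (\<lambda>(a::'e) f. \<Sum>b\<in>Basis. (a \<bullet> b) * E b p f)"
  have V: "V a \<in> tangent_space A p" for a
    unfolding V_def by (intro function_space_sum[OF T] Ep)
  define \<Phi> where "\<Phi> = (\<lambda>a::'e. \<Sum>c\<in>Basis. (\<Sum>b\<in>Basis. (a \<bullet> b) * G p (E b p) (E c p)) *\<^sub>R c)"
  have lin: "linear \<Phi>"
    unfolding \<Phi>_def
    by (rule linearI)
       (simp_all add: inner_add_left distrib_right sum.distrib scaleR_add_left scaleR_sum_right
         sum_distrib_left mult.assoc)
  have \<Phi>: "\<Phi> a \<bullet> c = G p (V a) (E c p)" if "c \<in> Basis" for a c
  proof -
    have "G p (V a) (E c p) = (\<Sum>b\<in>Basis. (a \<bullet> b) * G p (E b p) (E c p))"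
      unfolding V_def
      using linear_functional_on_sum[OF T bilinear_form_on_left[OF metric_bilinear[OF G] Ep[OF that]] Ep,
          of Basis "\<lambda>b. b"] by simp
    then show ?thesis using that by (simp add: \<Phi>_def)
  qed
  have "inj \<Phi>"
    unfolding linear_injective_0[OF lin]
  proof (intro allI impI)
    fix a assume a: "\<Phi> a = 0"
    have "G p (V a) w = 0" if "w \<in> tangent_space A p" for w
      using determined[OF bilinear_form_on_right[OF metric_bilinear[OF G] V] _ _ that, of "\<lambda>w. 0" a] \<Phi>[of _ a] a
      by (simp add: linear_functional_on_def)
    then have "V a = (\<lambda>f. 0)" by (rule metric_nondegenerate[OF G V])
    then have V0: "V a f = 0" for f by simp
    have "a \<bullet> c = 0" if "c \<in> Basis" for c
    proof -
      have "V a (x c) = (\<Sum>b\<in>Basis. (a \<bullet> b) * (if b = c then 1 else 0))"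
        unfolding V_def using that by (intro sum.cong) (auto simp: frame_dual[OF fr])
      also have "\<dots> = a \<bullet> c" using that by (simp add: if_distrib cong: if_cong)
      finally show ?thesis by (simp add: V0)
    qed
    then show "a = 0" by (auto intro: euclidean_eqI)
  qed
  then have "surj \<Phi>" by (rule linear_injective_imp_surjective[OF lin]) simp
  then obtain a where a: "(\<Sum>c\<in>Basis. \<xi> (E c p) *\<^sub>R c) = \<Phi> a" by (rule surjE)
  have "G p (V a) (E c p) = \<xi> (E c p)" if "c \<in> Basis" for c
    using \<Phi>[OF that, of a] that by (simp add: a[symmetric])
  then have "\<forall>w\<in>tangent_space A p. G p (V a) w = \<xi> w"
    using determined[OF bilinear_form_on_right[OF metric_bilinear[OF G] V] cotangent_linear[OF \<xi>]] by blast
  then show ?thesis using V by blast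
qed

lemma metric_sharp_unique:
  assumes M: "smooth_manifold A" and G: "pseudo_riemannian_metric A G"
    and v: "v \<in> tangent_space A p" and w: "w \<in> tangent_space A p"
    and eq: "\<And>u. u \<in> tangent_space A p \<Longrightarrow> G p v u = G p w u"
  shows "v = w"
proof -
  have T: "function_space (tangent_space A p)" using M by (rule function_space_tangent)
  have w': "(\<lambda>f. -1 * w f) \<in> tangent_space A p" by (rule function_space_scale[OF T w])
  have "(\<lambda>f. v f + -1 * w f) = (\<lambda>f. 0)"
  proof (rule metric_nondegenerate[OF G])
    show "(\<lambda>f. v f + -1 * w f) \<in> tangent_space A p" by (rule function_space_add[OF T v w'])
    fix u assume u: "u \<in> tangent_space A p"
    note L = bilinear_form_on_left[OF metric_bilinear[OF G] u]
    show "G p (\<lambda>f. v f + -1 * w f) u = 0"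
      using linear_functional_on_add[OF L v w'] linear_functional_on_scale[OF L w, of "-1"] eq[OF u] by simp
  qed
  then show ?thesis by (simp add: fun_eq_iff)
qed

lemma
  assumes M: "smooth_manifold A" and G: "pseudo_riemannian_metric A G"
    and \<xi>: "\<xi> \<in> cotangent_space A p"
  shows metric_sharp_tangent: "metric_sharp A G p \<xi> \<in> tangent_space A p"
    and metric_sharp_eq: "w \<in> tangent_space A p \<Longrightarrow> G p (metric_sharp A G p \<xi>) w = \<xi> w"
proof -
  have "\<exists>!v. v \<in> tangent_space A p \<and> (\<forall>w\<in>tangent_space A p. G p v w = \<xi> w)"
  proof (rule ex_ex1I)
    show "v = w" if "v \<in> tangent_space A p \<and> (\<forall>u\<in>tangent_space A p. G p v u = \<xi> u)"
      "w \<in> tangent_space A p \<and> (\<forall>u\<in>tangent_space A p. G p w u = \<xi> u)" for v w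
      by (rule metric_sharp_unique[OF M G]) (use that in auto)
  qed (use metric_surjective[OF M G \<xi>] in blast)
  from theI'[OF this] show "metric_sharp A G p \<xi> \<in> tangent_space A p"
    "w \<in> tangent_space A p \<Longrightarrow> G p (metric_sharp A G p \<xi>) w = \<xi> w"
    unfolding metric_sharp_def by auto
qed

lemma dual_metric_eq:
  assumes "smooth_manifold A" "pseudo_riemannian_metric A G"
    "\<xi> \<in> cotangent_space A p" "\<eta> \<in> cotangent_space A p"
  shows "dual_metric A G p \<xi> \<eta> = \<xi> (metric_sharp A G p \<eta>)"
  unfolding dual_metric_def
  by (rule metric_sharp_eq[OF assms(1-3) metric_sharp_tangent[OF assms(1,2,4)]])

lemma dual_metric_sym:
  assumes "smooth_manifold A" "pseudo_riemannian_metric A G"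
    "\<xi> \<in> cotangent_space A p" "\<eta> \<in> cotangent_space A p"
  shows "dual_metric A G p \<xi> \<eta> = dual_metric A G p \<eta> \<xi>"
  unfolding dual_metric_def
  by (rule metric_sym[OF assms(2) metric_sharp_tangent[OF assms(1-3)] metric_sharp_tangent[OF assms(1,2,4)]])

lemma cotangent_diff:
  assumes "\<xi> \<in> cotangent_space A p" "\<eta> \<in> cotangent_space A p"
  shows "(\<lambda>v. \<xi> v - \<eta> v) \<in> cotangent_space A p"
  using assms by (auto simp: cotangent_space_def linear_functional_on_def algebra_simps)

lemma dual_metric_diff_left:
  assumes "smooth_manifold A" "pseudo_riemannian_metric A G"
    "\<xi> \<in> cotangent_space A p" "\<zeta> \<in> cotangent_space A p" "\<eta> \<in> cotangent_space A p"
  shows "dual_metric A G p (\<lambda>v. \<xi> v - \<zeta> v) \<eta> = dual_metric A G p \<xi> \<eta> - dual_metric A G p \<zeta> \<eta>"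
  using assms by (simp add: dual_metric_eq cotangent_diff)

text \<open>Pairing with the one-form through \<open>G(w, _)\<close> at p evaluates a covector at w.\<close>

lemma dual_metric_nondegenerate:
  assumes M: "smooth_manifold A" and G: "pseudo_riemannian_metric A G"
    and \<xi>: "\<xi> \<in> cotangent_space A p" and \<zeta>: "\<zeta> \<in> cotangent_space A p"
    and eq: "\<And>\<gamma>. \<gamma> \<in> one_forms A \<Longrightarrow> dual_metric A G p \<xi> (\<gamma> p) = dual_metric A G p \<zeta> (\<gamma> p)"
  shows "\<xi> = \<zeta>"
proof
  fix w
  show "\<xi> w = \<zeta> w"
  proof (cases "w \<in> tangent_space A p")
    case True
    define \<eta> where "\<eta> = (\<lambda>u. if u \<in> tangent_space A p then G p w u else 0)"
    have "\<eta> \<in> cotangent_space A p"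
      using bilinear_form_on_right[OF metric_bilinear[OF G] True] function_space_tangent[OF M, of p]
      by (auto simp: cotangent_space_def \<eta>_def linear_functional_on_def function_space_def)
    then have \<eta>: "\<eta> \<in> cotangent_space A p" and sharp: "metric_sharp A G p \<eta> = w"
      by (auto intro!: metric_sharp_unique[OF M G _ True] simp: metric_sharp_tangent[OF M G] metric_sharp_eq[OF M G])
         (simp add: \<eta>_def)
    obtain \<gamma> where "\<gamma> \<in> one_forms A" "\<gamma> p = \<eta>" using covector_extends[OF M \<eta>] .
    with eq[of \<gamma>] show ?thesis
      by (simp add: dual_metric_eq[OF M G _ \<eta>] \<xi> \<zeta> sharp)
  qed (simp add: cotangent_extensional[OF \<xi>] cotangent_extensional[OF \<zeta>])
qed

section \<open>The Koszul bracket of one-forms\<close>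

text \<open>The tensor characterization lemma.  The value of \<open>T Y\<close> at p depends only on \<open>Y p\<close>: for a frame
  around p the field \<open>\<kappa> Y\<close> is globally the combination of the E b with coefficients \<open>Y (x b)\<close>, so T takes it
  at p to the sum of the \<open>Y p (x b)\<close> times \<open>T (E b) p\<close>, while \<open>T (\<kappa> Y)\<close> and \<open>T Y\<close> agree at p.  The one-form is
  then evaluated at v by means of any vector field through v.\<close>

lemma tensorial_is_one_form:
  fixes A :: "('m::{t2_space,second_countable_topology}, 'e::euclidean_space) chart set"
  assumes M: "smooth_manifold A"
    and smooth: "\<And>Y. Y \<in> vector_fields A \<Longrightarrow> T Y \<in> smooth_funs A"
    and add: "\<And>Y Z q. Y \<in> vector_fields A \<Longrightarrow> Z \<in> vector_fields A \<Longrightarrow>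
      T (\<lambda>p f. Y p f + Z p f) q = T Y q + T Z q"
    and mult: "\<And>h Y q. h \<in> smooth_funs A \<Longrightarrow> Y \<in> vector_fields A \<Longrightarrow>
      T (\<lambda>p f. h p * Y p f) q = h q * T Y q"
  shows "\<exists>!\<omega>. \<omega> \<in> one_forms A \<and> (\<forall>Y\<in>vector_fields A. \<forall>p. \<omega> p (Y p) = T Y p)"
proof -
  have T0: "T (\<lambda>p f. 0) q = 0" for q
    using mult[OF smooth_funs_const[of 0] vector_fields_zero[OF M], of q] by simp
  have Tsum: "T (\<lambda>p f. \<Sum>i\<in>I. h i p * X i p f) q = (\<Sum>i\<in>I. h i q * T (X i) q)"
    if "finite I" "\<And>i. i \<in> I \<Longrightarrow> h i \<in> smooth_funs A" "\<And>i. i \<in> I \<Longrightarrow> X i \<in> vector_fields A"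
    for I :: "'e set" and h X q
    using that
    by (induction I rule: finite_induct)
       (simp_all add: T0 add mult vector_fields_mult[OF M] vector_fields_sum[OF M])
  have pointwise: "T Y p = T Z p"
    if Y: "Y \<in> vector_fields A" and Z: "Z \<in> vector_fields A" and eq: "Y p = Z p" for Y Z p
  proof -
    obtain x E \<kappa> where fr: "frame_around A p x E \<kappa>" by (rule frame_exists[OF M])
    have "T W p = (\<Sum>b\<in>Basis. W p (x b) * T (E b) p)" if W: "W \<in> vector_fields A" for W
    proof -
      have "T W p = T (\<lambda>q f. \<kappa> q * W q f) p" using mult[OF frame_cutoff(1)[OF fr] W] frame_cutoff(2)[OF fr] by simp
      also have "(\<lambda>q f. \<kappa> q * W q f) = (\<lambda>q f. \<Sum>b\<in>Basis. W q (x b) * E b q f)"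
        by (simp add: frame_cutoff_expand[OF fr vector_fields_tangent[OF W]])
      also have "T \<dots> p = (\<Sum>b\<in>Basis. W p (x b) * T (E b) p)"
        by (rule Tsum) (auto intro: vector_fields_smooth[OF W] frame_function[OF fr] frame_field[OF fr])
      finally show ?thesis .
    qed
    then show ?thesis using Y Z eq by simp
  qed
  define extend where "extend = (\<lambda>p v. SOME Y. Y \<in> vector_fields A \<and> Y p = v)"
  have extend: "extend p v \<in> vector_fields A" "extend p v p = v" if "v \<in> tangent_space A p" for p v
    using someI_ex[of "\<lambda>Y. Y \<in> vector_fields A \<and> Y p = v"] tangent_vector_extends[OF M that]
    unfolding extend_def by metis+
  define \<omega> where "\<omega> = (\<lambda>p v. if v \<in> tangent_space A p then T (extend p v) p else 0)"
  have \<omega>: "\<omega> p (Y p) = T Y p" if "Y \<in> vector_fields A" for Y p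
  proof -
    note v = vector_fields_tangent[OF that, of p]
    have "T (extend p (Y p)) p = T Y p"
      by (rule pointwise[OF extend(1)[OF v] that extend(2)[OF v]])
    then show ?thesis using v by (simp add: \<omega>_def)
  qed
  have "linear_functional_on (tangent_space A p) (\<omega> p)" for p
    unfolding linear_functional_on_def
  proof (intro conjI ballI allI)
    fix v w assume v: "v \<in> tangent_space A p" and w: "w \<in> tangent_space A p"
    show "\<omega> p (\<lambda>f. v f + w f) = \<omega> p v + \<omega> p w"
      using \<omega>[OF vector_fields_add[OF M extend(1)[OF v] extend(1)[OF w]], of p]
        \<omega>[OF extend(1)[OF v], of p] \<omega>[OF extend(1)[OF w], of p]
      by (simp add: add extend v w)
  next
    fix c v assume v: "v \<in> tangent_space A p"
    show "\<omega> p (\<lambda>f. c * v f) = c * \<omega> p v"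
      using \<omega>[OF vector_fields_mult[OF M extend(1)[OF v] smooth_funs_const[of c]], of p]
        \<omega>[OF extend(1)[OF v], of p]
      by (simp add: mult smooth_funs_const extend v)
  qed
  moreover have "\<omega> p v = 0" if "v \<notin> tangent_space A p" for p v
    using that by (simp add: \<omega>_def)
  ultimately have form: "\<omega> \<in> one_forms A"
    unfolding one_forms_def cotangent_space_def using \<omega> smooth by simp
  show ?thesis
  proof (rule ex1I)
    show "\<omega> \<in> one_forms A \<and> (\<forall>Y\<in>vector_fields A. \<forall>p. \<omega> p (Y p) = T Y p)"
      using form \<omega> by blast
    fix \<omega>' assume \<omega>': "\<omega>' \<in> one_forms A \<and> (\<forall>Y\<in>vector_fields A. \<forall>p. \<omega>' p (Y p) = T Y p)"
    show "\<omega>' = \<omega>"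
    proof (intro ext)
      fix p v
      show "\<omega>' p v = \<omega> p v"
      proof (cases "v \<in> tangent_space A p")
        case True
        then show ?thesis using tangent_vector_extends[OF M True] \<omega> \<omega>' by metis
      next
        case False
        then show ?thesis
          using cotangent_extensional one_forms_cotangent form \<omega>' by metis
      qed
    qed
  qed
qed

lemma lie_bracket_vector_field:
  assumes M: "smooth_manifold A" and X: "X \<in> vector_fields A" and Y: "Y \<in> vector_fields A"
  shows "lie_bracket A X Y \<in> vector_fields A"
proof -
  note T = vector_fields_tangent[OF X] vector_fields_tangent[OF Y]
  note S = vector_fields_smooth[OF X] vector_fields_smooth[OF Y]
  note V = tangent_add[OF T(1)] tangent_add[OF T(2)] tangent_scale[OF T(1)] tangent_scale[OF T(2)]
    tangent_mult[OF T(1)] tangent_mult[OF T(2)]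
  have "lie_bracket A X Y p \<in> tangent_space A p" for p
    by (auto simp: tangent_space_def linear_functional_on_def lie_bracket_def V S algebra_simps
        smooth_funs_add[OF M] smooth_funs_mult[OF M] smooth_funs_const)
  then show ?thesis
    by (auto simp: vector_fields_def lie_bracket_def intro!: smooth_funs_diff[OF M] S)
qed

text \<open>The defining expression of the Lie derivative is tensorial in Y: replacing Y by \<open>h Y\<close> makes both
  terms contribute \<open>X(h) \<beta>(Y)\<close>, and these contributions cancel.  Hence the description by which the Lie
  derivative is defined has exactly one solution.\<close>

lemma lie_derivative_one_form:
  assumes M: "smooth_manifold A" and X: "X \<in> vector_fields A" and \<beta>: "\<beta> \<in> one_forms A"
  shows "lie_derivative A X \<beta> \<in> one_forms A"
proof -
  let ?T = "\<lambda>Y p. X p (\<lambda>q. \<beta> q (Y q)) - \<beta> p (lie_bracket A X Y p)"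
  note TX = vector_fields_tangent[OF X]
  note \<beta>L = cotangent_linear[OF one_forms_cotangent[OF \<beta>]]
  have "\<exists>!\<omega>. \<omega> \<in> one_forms A \<and> (\<forall>Y\<in>vector_fields A. \<forall>p. \<omega> p (Y p) = ?T Y p)"
  proof (rule tensorial_is_one_form[OF M])
    fix Y assume Y: "Y \<in> vector_fields A"
    show "?T Y \<in> smooth_funs A"
      by (intro smooth_funs_diff[OF M] vector_fields_smooth[OF X] one_forms_smooth[OF \<beta>]
          lie_bracket_vector_field[OF M X] Y)
  next
    fix Y Z p assume Y: "Y \<in> vector_fields A" and Z: "Z \<in> vector_fields A"
    have "lie_bracket A X (\<lambda>p f. Y p f + Z p f) p = (\<lambda>f. lie_bracket A X Y p f + lie_bracket A X Z p f)"
      using Y Z by (auto simp: lie_bracket_def tangent_add[OF TX] vector_fields_smooth)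
    then show "?T (\<lambda>p f. Y p f + Z p f) p = ?T Y p + ?T Z p"
      using Y Z by (simp add: linear_functional_on_add[OF \<beta>L] vector_fields_tangent
          lie_bracket_vector_field[OF M X] tangent_add[OF TX] one_forms_smooth[OF \<beta>])
  next
    fix h Y p assume h: "h \<in> smooth_funs A" and Y: "Y \<in> vector_fields A"
    have T: "function_space (tangent_space A p)" using M by (rule function_space_tangent)
    have "lie_bracket A X (\<lambda>p f. h p * Y p f) p = (\<lambda>f. X p h * Y p f + h p * lie_bracket A X Y p f)"
      using h vector_fields_smooth[OF Y] tangent_extensional[OF vector_fields_tangent[OF Y]]
      by (intro ext) (simp add: lie_bracket_def tangent_mult[OF TX] algebra_simps)
    moreover have "\<beta> p (\<lambda>f. X p h * Y p f + h p * lie_bracket A X Y p f) =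
        X p h * \<beta> p (Y p) + h p * \<beta> p (lie_bracket A X Y p)"
    proof -
      note t = vector_fields_tangent[OF Y, of p] vector_fields_tangent[OF lie_bracket_vector_field[OF M X Y], of p]
      show ?thesis
        using t T by (subst linear_functional_on_add[OF \<beta>L])
          (auto simp: function_space_def linear_functional_on_scale[OF \<beta>L])
    qed
    ultimately show "?T (\<lambda>p f. h p * Y p f) p = h p * ?T Y p"
      using Y h by (simp add: linear_functional_on_scale[OF \<beta>L] vector_fields_tangent
          tangent_mult[OF TX] one_forms_smooth[OF \<beta>] algebra_simps)
  qed
  from theI'[OF this] show ?thesis unfolding lie_derivative_def by blast
qed

text \<open>Smoothness is tested on a function f, where the anchor of \<open>\<alpha>\<close> gives \<open>\<pi>(\<alpha>, df)\<close>.\<close>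

lemma anchor_vector_field:
  assumes M: "smooth_manifold A" and \<pi>: "bivector_field A \<pi>" and \<alpha>: "\<alpha> \<in> one_forms A"
  shows "anchor A \<pi> \<alpha> \<in> vector_fields A"
proof -
  have *: "anchor A \<pi> \<alpha> p \<in> tangent_space A p \<and>
      (\<forall>\<xi>\<in>cotangent_space A p. \<xi> (anchor A \<pi> \<alpha> p) = \<pi> p (\<alpha> p) \<xi>)" for p
  proof -
    have "linear_functional_on (cotangent_space A p) (\<pi> p (\<alpha> p))"
      using bilinear_form_on_right[OF _ one_forms_cotangent[OF \<alpha>]] \<pi> unfolding bivector_field_def by blast
    from theI'[OF tangent_reflexive[OF M this]] show ?thesis unfolding anchor_def by blast
  qed
  have "(\<lambda>p. anchor A \<pi> \<alpha> p f) \<in> smooth_funs A" if f: "f \<in> smooth_funs A" for f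
  proof -
    have df: "differential A f \<in> one_forms A" by (rule differential_one_form[OF M f])
    have "anchor A \<pi> \<alpha> p f = \<pi> p (\<alpha> p) (differential A f p)" for p
      using * one_forms_cotangent[OF df, of p] by (auto simp: differential_def)
    then show ?thesis using \<pi> \<alpha> df unfolding bivector_field_def by simp
  qed
  then show "anchor A \<pi> \<alpha> \<in> vector_fields A" using * by (simp add: vector_fields_def)
qed

lemma koszul_bracket_one_form:
  assumes M: "smooth_manifold A" and \<pi>: "bivector_field A \<pi>"
    and \<alpha>: "\<alpha> \<in> one_forms A" and \<beta>: "\<beta> \<in> one_forms A"
  shows "koszul_bracket A \<pi> \<alpha> \<beta> \<in> one_forms A"
proof -
  have "(\<lambda>q. \<pi> q (\<alpha> q) (\<beta> q)) \<in> smooth_funs A"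
    using \<pi> \<alpha> \<beta> unfolding bivector_field_def by blast
  then show ?thesis
    unfolding koszul_bracket_def
    by (intro one_forms_diff[OF M] lie_derivative_one_form[OF M] anchor_vector_field[OF M \<pi>]
        differential_one_form[OF M] \<alpha> \<beta>)
qed

lemma bivector_antisym:
  "bivector_field A \<pi> \<Longrightarrow> \<xi> \<in> cotangent_space A p \<Longrightarrow> \<eta> \<in> cotangent_space A p \<Longrightarrow>
    \<pi> p \<xi> \<eta> = - \<pi> p \<eta> \<xi>"
  unfolding bivector_field_def by blast

lemma koszul_bracket_antisym:
  assumes M: "smooth_manifold A" and \<pi>: "bivector_field A \<pi>"
    and \<alpha>: "\<alpha> \<in> one_forms A" and \<beta>: "\<beta> \<in> one_forms A"
  shows "koszul_bracket A \<pi> \<beta> \<alpha> p v = - koszul_bracket A \<pi> \<alpha> \<beta> p v"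
proof -
  have "(\<lambda>q. \<pi> q (\<beta> q) (\<alpha> q)) = (\<lambda>q. -1 * \<pi> q (\<alpha> q) (\<beta> q))"
    using bivector_antisym[OF \<pi> one_forms_cotangent[OF \<beta>] one_forms_cotangent[OF \<alpha>]] by simp
  moreover have "(\<lambda>q. \<pi> q (\<alpha> q) (\<beta> q)) \<in> smooth_funs A"
    using \<pi> \<alpha> \<beta> unfolding bivector_field_def by blast
  ultimately have "differential A (\<lambda>q. \<pi> q (\<beta> q) (\<alpha> q)) p v = - differential A (\<lambda>q. \<pi> q (\<alpha> q) (\<beta> q)) p v"
    using tangent_scale[of v A p _ "-1"] by (simp add: differential_def)
  then show ?thesis by (simp add: koszul_bracket_def)
qed

section \<open>The contravariant Levi-Civita connection\<close>

locale levi_civita_setting =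
  fixes A :: "('m::{t2_space,second_countable_topology}, 'e::euclidean_space) chart set"
    and \<pi> :: "'m cotensor2" and G :: "'m tensor2" and D :: "'m form \<Rightarrow> 'm form \<Rightarrow> 'm form"
  assumes manifold: "smooth_manifold A" and bivector: "bivector_field A \<pi>"
    and metric: "pseudo_riemannian_metric A G"
    and levi_civita: "contravariant_levi_civita A \<pi> G D"
begin

abbreviation ip :: "'m \<Rightarrow> 'm covec \<Rightarrow> 'm covec \<Rightarrow> real" where
  "ip \<equiv> dual_metric A G"

abbreviation bracket :: "'m form \<Rightarrow> 'm form \<Rightarrow> 'm form" where
  "bracket \<equiv> koszul_bracket A \<pi>"

lemma connection_one_form:
  "\<alpha> \<in> one_forms A \<Longrightarrow> \<beta> \<in> one_forms A \<Longrightarrow> D \<alpha> \<beta> \<in> one_forms A"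
  using levi_civita unfolding contravariant_levi_civita_def by blast

lemma koszul_formula:
  assumes "\<alpha> \<in> one_forms A" "\<beta> \<in> one_forms A" "\<gamma> \<in> one_forms A"
  shows "2 * ip p (D \<alpha> \<beta> p) (\<gamma> p) =
      anchor A \<pi> \<alpha> p (\<lambda>q. ip q (\<beta> q) (\<gamma> q)) + anchor A \<pi> \<beta> p (\<lambda>q. ip q (\<alpha> q) (\<gamma> q))
    - anchor A \<pi> \<gamma> p (\<lambda>q. ip q (\<alpha> q) (\<beta> q)) + ip p (bracket \<alpha> \<beta> p) (\<gamma> p)
    - ip p (bracket \<alpha> \<gamma> p) (\<beta> p) - ip p (bracket \<beta> \<gamma> p) (\<alpha> p)"
  using levi_civita assms unfolding contravariant_levi_civita_def by blast

lemma ip_sym: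
  assumes "\<alpha> \<in> one_forms A" "\<beta> \<in> one_forms A"
  shows "ip p (\<alpha> p) (\<beta> p) = ip p (\<beta> p) (\<alpha> p)"
  by (rule dual_metric_sym[OF manifold metric assms[THEN one_forms_cotangent]])

lemma ip_bracket_antisym:
  assumes "\<alpha> \<in> one_forms A" "\<beta> \<in> one_forms A" "\<gamma> \<in> one_forms A"
  shows "ip p (bracket \<beta> \<alpha> p) (\<gamma> p) = - ip p (bracket \<alpha> \<beta> p) (\<gamma> p)"
proof -
  have "bracket \<alpha> \<beta> p \<in> cotangent_space A p" "bracket \<beta> \<alpha> p \<in> cotangent_space A p"
    by (auto intro!: one_forms_cotangent koszul_bracket_one_form[OF manifold bivector] assms)
  then show ?thesis
    using koszul_bracket_antisym[OF manifold bivector assms(1,2)]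
    by (simp add: dual_metric_eq[OF manifold metric _ one_forms_cotangent[OF assms(3)]])
qed

text \<open>The Koszul formulas for the pairs \<open>\<beta>, \<gamma>\<close> and \<open>\<gamma>, \<beta>\<close> are added; all brackets cancel by
  antisymmetry and only the derivative along \<open>\<alpha>\<close> survives, twice.\<close>

lemma metric_compatible:
  assumes "\<alpha> \<in> one_forms A" "\<beta> \<in> one_forms A" "\<gamma> \<in> one_forms A"
  shows "anchor A \<pi> \<alpha> p (\<lambda>q. ip q (\<beta> q) (\<gamma> q)) = ip p (D \<alpha> \<beta> p) (\<gamma> p) + ip p (\<beta> p) (D \<alpha> \<gamma> p)"
proof -
  have "(\<lambda>q. ip q (\<gamma> q) (\<beta> q)) = (\<lambda>q. ip q (\<beta> q) (\<gamma> q))"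
    using ip_sym[OF assms(3,2)] by blast
  then show ?thesis
    using koszul_formula[OF assms, of p] koszul_formula[OF assms(1,3,2), of p]
      ip_bracket_antisym[OF assms(2,3,1), of p]
      ip_sym[OF assms(2) connection_one_form[OF assms(1,3)], of p]
    by simp
qed

text \<open>The Koszul formulas for \<open>D \<alpha> \<beta>\<close> and \<open>D \<beta> \<alpha>\<close> are subtracted; the derivatives cancel and the bracket
  of \<open>\<alpha>\<close> and \<open>\<beta>\<close> survives, twice.  Nondegeneracy of the dual metric then removes the test form.\<close>

lemma torsion_free:
  assumes "\<alpha> \<in> one_forms A" "\<beta> \<in> one_forms A"
  shows "bracket \<alpha> \<beta> = (\<lambda>p v. D \<alpha> \<beta> p v - D \<beta> \<alpha> p v)"
proof
  fix p
  note D = connection_one_form[OF assms, THEN one_forms_cotangent, of p]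
    connection_one_form[OF assms(2,1), THEN one_forms_cotangent, of p]
  show "bracket \<alpha> \<beta> p = (\<lambda>v. D \<alpha> \<beta> p v - D \<beta> \<alpha> p v)"
  proof (rule dual_metric_nondegenerate[OF manifold metric])
    show "bracket \<alpha> \<beta> p \<in> cotangent_space A p"
      by (rule one_forms_cotangent[OF koszul_bracket_one_form[OF manifold bivector assms]])
    show "(\<lambda>v. D \<alpha> \<beta> p v - D \<beta> \<alpha> p v) \<in> cotangent_space A p" by (rule cotangent_diff[OF D])
    fix \<gamma> assume \<gamma>: "\<gamma> \<in> one_forms A"
    have "(\<lambda>q. ip q (\<beta> q) (\<alpha> q)) = (\<lambda>q. ip q (\<alpha> q) (\<beta> q))"
      using ip_sym[OF assms(2,1)] by blast
    then have "2 * (ip p (D \<alpha> \<beta> p) (\<gamma> p) - ip p (D \<beta> \<alpha> p) (\<gamma> p)) = 2 * ip p (bracket \<alpha> \<beta> p) (\<gamma> p)"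
      using koszul_formula[OF assms \<gamma>, of p] koszul_formula[OF assms(2,1) \<gamma>, of p]
        ip_bracket_antisym[OF assms \<gamma>, of p]
      by simp
    then show "ip p (bracket \<alpha> \<beta> p) (\<gamma> p) = ip p (\<lambda>v. D \<alpha> \<beta> p v - D \<beta> \<alpha> p v) (\<gamma> p)"
      using dual_metric_diff_left[OF manifold metric D one_forms_cotangent[OF \<gamma>]] by simp
  qed
qed

end

section \<open>Parallel structures and the Nijenhuis tensor\<close>

locale almost_kahler_setting = levi_civita_setting A \<pi> G D
  for A :: "('m::{t2_space,second_countable_topology}, 'e::euclidean_space) chart set"
    and \<pi> G D +
  fixes J :: "'m \<Rightarrow> 'm covec \<Rightarrow> 'm covec"
  assumes bundle_map: "cotangent_bundle_map A J"
    and compatible: "\<alpha> \<in> one_forms A \<Longrightarrow> \<beta> \<in> one_forms A \<Longrightarrow> \<pi> p (\<alpha> p) (\<beta> p) = ip p (\<alpha> p) (J p (\<beta> p))"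
begin

lemma J_one_form: "\<alpha> \<in> one_forms A \<Longrightarrow> apply_bundle_map J \<alpha> \<in> one_forms A"
  using bundle_map unfolding cotangent_bundle_map_def apply_bundle_map_def by blast

lemma J_cotangent: "\<xi> \<in> cotangent_space A p \<Longrightarrow> J p \<xi> \<in> cotangent_space A p"
  using bundle_map unfolding cotangent_bundle_map_def linear_endo_on_def by blast

lemma
  assumes "\<xi> \<in> cotangent_space A p" "\<eta> \<in> cotangent_space A p"
  shows J_add: "J p (\<lambda>v. \<xi> v + \<eta> v) = (\<lambda>v. J p \<xi> v + J p \<eta> v)"
    and J_diff: "J p (\<lambda>v. \<xi> v - \<eta> v) = (\<lambda>v. J p \<xi> v - J p \<eta> v)"
proof -
  have J: "linear_endo_on (cotangent_space A p) (J p)"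
    using bundle_map unfolding cotangent_bundle_map_def by blast
  then have add: "J p (\<lambda>v. x v + y v) = (\<lambda>v. J p x v + J p y v)"
    if "x \<in> cotangent_space A p" "y \<in> cotangent_space A p" for x y
    using that unfolding linear_endo_on_def by blast
  show "J p (\<lambda>v. \<xi> v + \<eta> v) = (\<lambda>v. J p \<xi> v + J p \<eta> v)" by (rule add[OF assms])
  have "(\<lambda>v. -1 * \<eta> v) \<in> cotangent_space A p"
    by (rule function_space_scale[OF function_space_cotangent assms(2)])
  from add[OF assms(1) this]
  have "J p (\<lambda>v. \<xi> v + -1 * \<eta> v) = (\<lambda>v. J p \<xi> v + J p (\<lambda>v. -1 * \<eta> v) v)" .
  moreover have "J p (\<lambda>v. -1 * \<eta> v) = (\<lambda>v. -1 * J p \<eta> v)"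
    using J assms(2) unfolding linear_endo_on_def by blast
  ultimately show "J p (\<lambda>v. \<xi> v - \<eta> v) = (\<lambda>v. J p \<xi> v - J p \<eta> v)" by simp
qed

text \<open>Since \<open>\<pi>(\<beta>, \<gamma>)\<close> is the inner product of \<open>\<beta>\<close> and \<open>J \<gamma>\<close>, metric compatibility applied to that pair
  turns the derivative of \<open>\<pi>\<close> into the derivative of J.\<close>

lemma nabla_pi_eq_nabla_J:
  assumes "\<alpha> \<in> one_forms A" "\<beta> \<in> one_forms A" "\<gamma> \<in> one_forms A"
  shows "nabla_pi A \<pi> D \<alpha> \<beta> \<gamma> p = ip p (nabla_J D J \<alpha> \<gamma> p) (\<beta> p)"
proof -
  let ?J = "apply_bundle_map J"
  have \<pi>: "\<pi> q (\<sigma> q) (\<tau> q) = ip q (\<sigma> q) (?J \<tau> q)" if "\<sigma> \<in> one_forms A" "\<tau> \<in> one_forms A" for \<sigma> \<tau> q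
    using compatible[OF that] by (simp add: apply_bundle_map_def)
  note D\<beta> = connection_one_form[OF assms(1,2)] and D\<gamma> = connection_one_form[OF assms(1,3)]
    and DJ\<gamma> = connection_one_form[OF assms(1) J_one_form[OF assms(3)]]
  have "nabla_pi A \<pi> D \<alpha> \<beta> \<gamma> p = ip p (\<beta> p) (D \<alpha> (?J \<gamma>) p) - ip p (\<beta> p) (?J (D \<alpha> \<gamma>) p)"
    using metric_compatible[OF assms(1,2) J_one_form[OF assms(3)], of p]
    by (simp add: nabla_pi_def \<pi> assms D\<beta> D\<gamma>)
  also have "\<dots> = ip p (D \<alpha> (?J \<gamma>) p) (\<beta> p) - ip p (?J (D \<alpha> \<gamma>) p) (\<beta> p)"
    using ip_sym[OF assms(2) DJ\<gamma>] ip_sym[OF assms(2) J_one_form[OF D\<gamma>]] by simp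
  also have "\<dots> = ip p (nabla_J D J \<alpha> \<gamma> p) (\<beta> p)"
    unfolding nabla_J_def
    by (rule dual_metric_diff_left[OF manifold metric, symmetric])
       (auto intro!: one_forms_cotangent DJ\<gamma> J_one_form[OF D\<gamma>] assms(2))
  finally show ?thesis .
qed

lemma nabla_J_one_form:
  "\<alpha> \<in> one_forms A \<Longrightarrow> \<beta> \<in> one_forms A \<Longrightarrow> nabla_J D J \<alpha> \<beta> \<in> one_forms A"
  unfolding nabla_J_def
  by (intro one_forms_diff[OF manifold] connection_one_form J_one_form)

lemma nabla_J_zero_iff:
  "nabla_J_zero A D J \<longleftrightarrow>
    (\<forall>\<alpha>\<in>one_forms A. \<forall>\<beta>\<in>one_forms A. \<forall>\<gamma>\<in>one_forms A. nabla_pi A \<pi> D \<alpha> \<beta> \<gamma> = (\<lambda>p. 0))"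
proof -
  have ip0: "ip p (\<lambda>v. 0) (\<beta> p) = 0" if "\<beta> \<in> one_forms A" for p \<beta>
    by (simp add: dual_metric_eq[OF manifold metric zero_cotangent one_forms_cotangent[OF that]])
  show ?thesis
    unfolding nabla_J_zero_def
  proof (intro iffI ballI ext)
    fix \<alpha> \<beta> \<gamma> p
    assume "\<forall>\<alpha>\<in>one_forms A. \<forall>\<beta>\<in>one_forms A. nabla_J D J \<alpha> \<beta> = (\<lambda>p v. 0)"
      and "\<alpha> \<in> one_forms A" "\<beta> \<in> one_forms A" "\<gamma> \<in> one_forms A"
    then show "nabla_pi A \<pi> D \<alpha> \<beta> \<gamma> p = 0" by (simp add: nabla_pi_eq_nabla_J ip0)
  next
    fix \<alpha> \<gamma> p v
    assume *: "\<forall>\<alpha>\<in>one_forms A. \<forall>\<beta>\<in>one_forms A. \<forall>\<gamma>\<in>one_forms A. nabla_pi A \<pi> D \<alpha> \<beta> \<gamma> = (\<lambda>p. 0)"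
      and \<alpha>: "\<alpha> \<in> one_forms A" and \<gamma>: "\<gamma> \<in> one_forms A"
    have "nabla_J D J \<alpha> \<gamma> p = (\<lambda>v. 0)"
    proof (rule dual_metric_nondegenerate[OF manifold metric
          one_forms_cotangent[OF nabla_J_one_form[OF \<alpha> \<gamma>]] zero_cotangent])
      fix \<beta> assume \<beta>: "\<beta> \<in> one_forms A"
      then have "nabla_pi A \<pi> D \<alpha> \<beta> \<gamma> p = 0" using * \<alpha> \<gamma> by simp
      then show "ip p (nabla_J D J \<alpha> \<gamma> p) (\<beta> p) = ip p (\<lambda>v. 0) (\<beta> p)"
        by (simp add: nabla_pi_eq_nabla_J \<alpha> \<beta> \<gamma> ip0)
    qed
    then show "nabla_J D J \<alpha> \<gamma> p v = 0" by simp
  qed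
qed

text \<open>Every bracket in the Nijenhuis tensor is a difference of two covariant derivatives, and the eight
  resulting terms, expanded by additivity of J, are those of the right-hand side.\<close>

lemma nijenhuis_eq_nabla_J:
  assumes \<alpha>: "\<alpha> \<in> one_forms A" and \<beta>: "\<beta> \<in> one_forms A"
  shows "nijenhuis A \<pi> J \<alpha> \<beta> = (\<lambda>p v.
      nabla_J D J (apply_bundle_map J \<alpha>) \<beta> p v - nabla_J D J (apply_bundle_map J \<beta>) \<alpha> p v
    - apply_bundle_map J (\<lambda>q w. nabla_J D J \<alpha> \<beta> q w - nabla_J D J \<beta> \<alpha> q w) p v)"
proof (intro ext)
  fix p v
  note J\<alpha> = J_one_form[OF \<alpha>] and J\<beta> = J_one_form[OF \<beta>]
  note C = connection_one_form[THEN one_forms_cotangent]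
  note cot = C[OF \<alpha> \<beta>] C[OF \<beta> \<alpha>] C[OF \<alpha> J\<beta>] C[OF \<beta> J\<alpha>] C[OF J\<alpha> \<beta>] C[OF J\<beta> \<alpha>]
  show "nijenhuis A \<pi> J \<alpha> \<beta> p v =
      nabla_J D J (apply_bundle_map J \<alpha>) \<beta> p v - nabla_J D J (apply_bundle_map J \<beta>) \<alpha> p v
    - apply_bundle_map J (\<lambda>q w. nabla_J D J \<alpha> \<beta> q w - nabla_J D J \<beta> \<alpha> q w) p v"
    unfolding nijenhuis_def torsion_free[OF \<alpha> \<beta>] torsion_free[OF J\<alpha> J\<beta>] torsion_free[OF \<alpha> J\<beta>]
      torsion_free[OF J\<alpha> \<beta>] nabla_J_def
    using cot
    by (simp add: apply_bundle_map_def J_add J_diff J_cotangent cotangent_diff)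
qed

lemma nijenhuis_zero:
  assumes "nabla_J_zero A D J" and \<alpha>: "\<alpha> \<in> one_forms A" and \<beta>: "\<beta> \<in> one_forms A"
  shows "nijenhuis A \<pi> J \<alpha> \<beta> = (\<lambda>p v. 0)"
proof -
  have z: "nabla_J D J \<sigma> \<tau> = (\<lambda>p v. 0)" if "\<sigma> \<in> one_forms A" "\<tau> \<in> one_forms A" for \<sigma> \<tau>
    using assms(1) that unfolding nabla_J_zero_def by blast
  have "J p (\<lambda>v. 0) = (\<lambda>v. 0)" for p
    using J_diff[OF zero_cotangent zero_cotangent] by simp
  then show ?thesis
    unfolding nijenhuis_eq_nabla_J[OF \<alpha> \<beta>] z[OF \<alpha> \<beta>] z[OF \<beta> \<alpha>]
      z[OF J_one_form[OF \<alpha>] \<beta>] z[OF J_one_form[OF \<beta>] \<alpha>]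
    by (simp add: apply_bundle_map_def)
qed

end

theorem proposition3p7:
  fixes A :: "('m::{t2_space,second_countable_topology}, 'e::euclidean_space) chart set"
    and \<pi> :: "'m cotensor2"
    and G :: "'m tensor2"
    and J :: "'m \<Rightarrow> 'm covec \<Rightarrow> 'm covec"
    and D :: "'m form \<Rightarrow> 'm form \<Rightarrow> 'm form"
  assumes akp: "almost_kahler_poisson A \<pi> G J"
    and lc: "contravariant_levi_civita A \<pi> G D"
  shows "(kahler_poisson A \<pi> G J D \<longleftrightarrow>
           (\<forall>\<alpha>\<in>one_forms A. \<forall>\<beta>\<in>one_forms A. \<forall>\<gamma>\<in>one_forms A.
              nabla_pi A \<pi> D \<alpha> \<beta> \<gamma> = (\<lambda>p. 0))) \<and>
         (\<forall>\<alpha>\<in>one_forms A. \<forall>\<beta>\<in>one_forms A.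
           nijenhuis A \<pi> J \<alpha> \<beta> = (\<lambda>p v.
               nabla_J D J (apply_bundle_map J \<alpha>) \<beta> p v
             - nabla_J D J (apply_bundle_map J \<beta>) \<alpha> p v
             - apply_bundle_map J (\<lambda>q w. nabla_J D J \<alpha> \<beta> q w - nabla_J D J \<beta> \<alpha> q w) p v)) \<and>
         (nabla_J_zero A D J \<longrightarrow>
           (\<forall>\<alpha>\<in>one_forms A. \<forall>\<beta>\<in>one_forms A. nijenhuis A \<pi> J \<alpha> \<beta> = (\<lambda>p v. 0)))"
proof -
  interpret almost_kahler_setting A \<pi> G D J
    by unfold_locales
       (use akp lc in \<open>auto simp: almost_kahler_poisson_def poisson_bivector_def apply_bundle_map_def\<close>)
  have "kahler_poisson A \<pi> G J D \<longleftrightarrow> nabla_J_zero A D J"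
    using akp lc unfolding kahler_poisson_def by blast
  then show ?thesis
    using nabla_J_zero_iff nijenhuis_eq_nabla_J nijenhuis_zero by simp
qed

end
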